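(* Suppose that a group $G$ admits a non-elementary convergence action on a compact metrizable space $M$. Then the action is geometrically infinite if and only if there exists an escaping sequence of hyperbolic elements in $G$.
   Context: An action of a group $G$ by homeomorphisms on a compact Hausdorff space $M$ is a convergence action if for every sequence $\{g_n\}$ of distinct elements of $G$ there are a subsequence $\{g_{n_i}\}$ and points $a,b\in M$ such that $g_{n_i}x\to b$ locally uniformly on $M\setminus\{a\}$. A sequence $\{g_n\}$ in $G$ with $g_nx\to b$ locally uniformly on $M\setminus\{a\}$ is called a convergence sequence with attracting point $b$ and repelling point $a$. The limit set $\Lambda H$ of a subgroup $H\le G$ is the set of attracting points of convergence sequences in $H$. The action is non-elementary if $\#\Lambda G>2$. An element $g\in G$ of infinite order is hyperbolic if it has exactly two fixed points in $M$; these are denoted $g^+$ (attracting) and $g^-$ (repelling). A point $\xi\in M$ is conical if there is a convergence sequence $\{g_n\}$ with attracting point $b\in M$ and repelling point $\xi$ such that $\{g_n\xi\}$ converges to a point different from $b$. A point $\xi\in M$ is parabolic if its stabilizer $G_\xi$ is infinite and $\Lambda G_\xi=\{\xi\}$; a parabolic point $\xi$ is bounded parabolic if $G_\xi$ acts cocompactly on $\Lambda G\setminus\{\xi\}$. The action is geometrically finite if every point of $\Lambda G$ is conical or bounded parabolic, and geometrically infinite otherwise. A sequence $\{g_n\}$ of hyperbolic elements of $G$ is escaping if $\lim_{n\to\infty}\sup_{h\in G}d(hg_n^+,hg_n^-)=0$, where $d$ is a compatible metric on $M$ (a metric inducing the topology of $M$). *)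

theory Defs
  imports "HOL-Analysis.Analysis" "HOL-Algebra.Group_Action" "HOL-Algebra.Multiplicative_Group"
begin

text \<open>
  The space \<open>M\<close> is the type \<open>'m\<close>, its metric \<open>dist\<close> being the chosen compatible metric. The
  definitions are meant for \<open>compact (UNIV :: 'm set)\<close>; uniform convergence then depends
  only on the topology. An action \<open>\<phi>\<close> is a left action: \<open>group_action\<close> makes \<open>\<phi>\<close> a
  homomorphism to the bijections of \<open>'m\<close> under composition.
\<close>

definition homeo_action :: "('g, 'c) monoid_scheme \<Rightarrow> ('g \<Rightarrow> 'm::metric_space \<Rightarrow> 'm) \<Rightarrow> bool" where
  "homeo_action G \<phi> \<longleftrightarrow> group_action G UNIV \<phi> \<and>
     (\<forall>g\<in>carrier G. homeomorphism UNIV UNIV (\<phi> g) (\<phi> (inv\<^bsub>G\<^esub> g)))"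

text \<open>
  \<open>convergence_sequence \<phi> H g b a\<close>: the sequence \<open>g\<close> lies in \<open>H\<close> and \<open>g n x\<close> tends to the attracting
  point \<open>b\<close> locally uniformly for \<open>x\<close> off the repelling point \<open>a\<close>. Note the order of \<open>b\<close> and \<open>a\<close>.
\<close>

definition convergence_sequence ::
    "('g \<Rightarrow> 'm::metric_space \<Rightarrow> 'm) \<Rightarrow> 'g set \<Rightarrow> (nat \<Rightarrow> 'g) \<Rightarrow> 'm \<Rightarrow> 'm \<Rightarrow> bool" where
  "convergence_sequence \<phi> H g b a \<longleftrightarrow> range g \<subseteq> H \<and>
     (\<forall>x \<in> - {a}. \<exists>V. open V \<and> x \<in> V \<and> V \<subseteq> - {a} \<and>
        uniform_limit V (\<lambda>n. \<phi> (g n)) (\<lambda>_. b) sequentially)"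

definition convergence_action :: "('g, 'c) monoid_scheme \<Rightarrow> ('g \<Rightarrow> 'm::metric_space \<Rightarrow> 'm) \<Rightarrow> bool" where
  "convergence_action G \<phi> \<longleftrightarrow> homeo_action G \<phi> \<and>
     (\<forall>g :: nat \<Rightarrow> 'g. range g \<subseteq> carrier G \<and> inj g \<longrightarrow>
        (\<exists>r a b. strict_mono r \<and> convergence_sequence \<phi> (carrier G) (g \<circ> r) b a))"

definition limit_set :: "('g \<Rightarrow> 'm::metric_space \<Rightarrow> 'm) \<Rightarrow> 'g set \<Rightarrow> 'm set" where
  "limit_set \<phi> H = {b. \<exists>g a. convergence_sequence \<phi> H g b a}"

text \<open>The disjunct \<open>infinite\<close> is needed because \<open>card\<close> is 0 on infinite sets.\<close>

definition non_elementary :: "('g, 'c) monoid_scheme \<Rightarrow> ('g \<Rightarrow> 'm::metric_space \<Rightarrow> 'm) \<Rightarrow> bool" where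
  "non_elementary G \<phi> \<longleftrightarrow>
     infinite (limit_set \<phi> (carrier G)) \<or> card (limit_set \<phi> (carrier G)) > 2"

text \<open>\<open>group.ord G g = 0\<close> is the library's encoding of infinite order.\<close>

definition hyperbolic :: "('g, 'c) monoid_scheme \<Rightarrow> ('g \<Rightarrow> 'm::metric_space \<Rightarrow> 'm) \<Rightarrow> 'g \<Rightarrow> bool" where
  "hyperbolic G \<phi> g \<longleftrightarrow> g \<in> carrier G \<and> group.ord G g = 0 \<and> card (invariants UNIV \<phi> g) = 2"

text \<open>
  Of the two fixed points of a hyperbolic \<open>g\<close>, the attracting one and the repelling one are those of
  the sequence of positive powers of \<open>g\<close>.
\<close>

definition attracting_fixed_point ::
    "('g, 'c) monoid_scheme \<Rightarrow> ('g \<Rightarrow> 'm::metric_space \<Rightarrow> 'm) \<Rightarrow> 'g \<Rightarrow> 'm" where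
  "attracting_fixed_point G \<phi> g = (THE b. \<exists>a. invariants UNIV \<phi> g = {b, a} \<and>
     convergence_sequence \<phi> (carrier G) (\<lambda>n::nat. g [^]\<^bsub>G\<^esub> n) b a)"

definition repelling_fixed_point ::
    "('g, 'c) monoid_scheme \<Rightarrow> ('g \<Rightarrow> 'm::metric_space \<Rightarrow> 'm) \<Rightarrow> 'g \<Rightarrow> 'm" where
  "repelling_fixed_point G \<phi> g = (THE a. \<exists>b. invariants UNIV \<phi> g = {b, a} \<and>
     convergence_sequence \<phi> (carrier G) (\<lambda>n::nat. g [^]\<^bsub>G\<^esub> n) b a)"

definition conical :: "('g, 'c) monoid_scheme \<Rightarrow> ('g \<Rightarrow> 'm::metric_space \<Rightarrow> 'm) \<Rightarrow> 'm \<Rightarrow> bool" where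
  "conical G \<phi> \<xi> \<longleftrightarrow> (\<exists>g b c. convergence_sequence \<phi> (carrier G) g b \<xi> \<and>
     (\<lambda>n. \<phi> (g n) \<xi>) \<longlonglongrightarrow> c \<and> c \<noteq> b)"

definition parabolic :: "('g, 'c) monoid_scheme \<Rightarrow> ('g \<Rightarrow> 'm::metric_space \<Rightarrow> 'm) \<Rightarrow> 'm \<Rightarrow> bool" where
  "parabolic G \<phi> \<xi> \<longleftrightarrow> infinite (stabilizer G \<phi> \<xi>) \<and> limit_set \<phi> (stabilizer G \<phi> \<xi>) = {\<xi>}"

text \<open>Cocompactness of \<open>H\<close> on an invariant set \<open>X\<close>: the translates of some compact subset cover \<open>X\<close>.\<close>

definition acts_cocompactly :: "('g \<Rightarrow> 'm::metric_space \<Rightarrow> 'm) \<Rightarrow> 'g set \<Rightarrow> 'm set \<Rightarrow> bool" where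
  "acts_cocompactly \<phi> H X \<longleftrightarrow> (\<exists>K. compact K \<and> K \<subseteq> X \<and> (\<Union>h\<in>H. \<phi> h ` K) = X)"

definition bounded_parabolic ::
    "('g, 'c) monoid_scheme \<Rightarrow> ('g \<Rightarrow> 'm::metric_space \<Rightarrow> 'm) \<Rightarrow> 'm \<Rightarrow> bool" where
  "bounded_parabolic G \<phi> \<xi> \<longleftrightarrow> parabolic G \<phi> \<xi> \<and>
     acts_cocompactly \<phi> (stabilizer G \<phi> \<xi>) (limit_set \<phi> (carrier G) - {\<xi>})"

definition geometrically_finite ::
    "('g, 'c) monoid_scheme \<Rightarrow> ('g \<Rightarrow> 'm::metric_space \<Rightarrow> 'm) \<Rightarrow> bool" where
  "geometrically_finite G \<phi> \<longleftrightarrow>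
     (\<forall>\<xi> \<in> limit_set \<phi> (carrier G). conical G \<phi> \<xi> \<or> bounded_parabolic G \<phi> \<xi>)"

definition geometrically_infinite ::
    "('g, 'c) monoid_scheme \<Rightarrow> ('g \<Rightarrow> 'm::metric_space \<Rightarrow> 'm) \<Rightarrow> bool" where
  "geometrically_infinite G \<phi> \<longleftrightarrow> \<not> geometrically_finite G \<phi>"

text \<open>The real supremum is over a nonempty set, bounded since \<open>'m\<close> is compact.\<close>

definition escaping ::
    "('g, 'c) monoid_scheme \<Rightarrow> ('g \<Rightarrow> 'm::metric_space \<Rightarrow> 'm) \<Rightarrow> (nat \<Rightarrow> 'g) \<Rightarrow> bool" where
  "escaping G \<phi> g \<longleftrightarrow>
     (\<lambda>n. SUP h\<in>carrier G. dist (\<phi> h (attracting_fixed_point G \<phi> (g n)))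
                                (\<phi> h (repelling_fixed_point G \<phi> (g n)))) \<longlonglongrightarrow> 0"

end

theory Submission
  imports Defs
begin

text \<open>
  Both directions assign to a configuration in the orbit of a point or a pair a natural number
  counting the group elements that separate it from the rest of the space, and move the
  configuration so as to minimise this number.

  Suppose \<open>g n\<close> is escaping. All translates of the pair \<open>(g n\<^sup>+, g n\<^sup>-)\<close> have diameter at most
  \<open>\<epsilon> n \<longlonglongrightarrow> 0\<close>. Choose scales \<open>u 0 > u 1 > \<dots>\<close> decreasing so fast that for distinct \<open>x\<close>, \<open>y\<close> only
  finitely many annuli \<open>{z. u (r + 1) \<le> dist (g z) (g x) < u r}\<close>, with \<open>g\<close> in the group and \<open>r\<close> a
  natural number, separate \<open>{x, y}\<close> from the points far from \<open>x\<close>, and let \<open>depth x y\<close> be the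
  length of the longest nested chain of such annuli. Replace each pair by a translate of minimal
  depth and pass to a limit \<open>\<xi>\<close> of the pairs. If \<open>\<xi>\<close> is conical or bounded parabolic, there are
  group elements \<open>h n\<close> contracting the complement of \<open>\<xi>\<close> to a point \<open>b\<close> and moving the pairs to
  some \<open>c \<noteq> b\<close>. Applying \<open>h n\<close> loses arbitrarily many of the annuli around \<open>\<xi>\<close> itself, and the only
  annuli it can gain are those separating \<open>{b, c}\<close> from the rest, whose number is bounded. This
  contradicts minimality.

  Suppose conversely that every hyperbolic \<open>\<gamma>\<close> has a translate of its fixed point pair of diameter
  at least \<open>\<delta>\<close>, and let \<open>\<xi>\<close> be a limit point that is not conical. Only finitely many elements
  separate a point of the orbit of \<open>\<xi>\<close> from the rest at scale \<open>v\<close>; call the point terminal if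
  this set cannot be made smaller by applying one of its elements. Strongly contracting elements
  carrying one terminal point to another are hyperbolic with axes ending near the two points. If
  terminal points accumulate, such an axis lies near the accumulation point, and a translate of it of
  diameter at least \<open>\<delta>\<close> would separate some terminal point further. Hence there are only finitely
  many terminal points, which makes the stabilizer of \<open>\<xi>\<close> infinite and cocompact.
\<close>

section \<open>Convergence sequences\<close>

text \<open>
  Whichever point \<open>a\<close> is repelling and wherever \<open>x\<close> lies, one of the finitely many test points is
  attracted and stays at distance \<open>u\<close> from \<open>x\<close>.
\<close>

definition test_points :: "'m::metric_space set \<Rightarrow> real \<Rightarrow> bool" where
  "test_points T u \<longleftrightarrow> finite T \<and> 0 < u \<and> (\<forall>a b. \<exists>p\<in>T. p \<noteq> a \<and> p \<noteq> b)
     \<and> (\<forall>a x. \<exists>p\<in>T. p \<noteq> a \<and> u \<le> dist p x)"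

text \<open>Half the least pairwise distance serves as \<open>u\<close>: two of the points closer
  than \<open>u\<close> to \<open>x\<close> would be too close to each other. So at most one point
  is near \<open>x\<close>, at most one equals \<open>a\<close>, and a third remains.\<close>

lemma test_points_exist:
  assumes "(p::'m::metric_space) \<noteq> q" "q \<noteq> r" "p \<noteq> r"
  shows "\<exists>T u. test_points (T :: 'm set) u"
proof -
  define u where "u = min (dist p q) (min (dist q r) (dist p r)) / 2"
  have u: "u > 0" "2 * u \<le> dist p q" "2 * u \<le> dist q r" "2 * u \<le> dist p r"
    using assms by (auto simp: u_def)
  have far: "\<exists>z\<in>{p,q,r}. z \<noteq> a \<and> u \<le> dist z x" for a x
  proof (rule ccontr)
    assume "\<not> ?thesis"
    hence *: "p = a \<or> dist p x < u" "q = a \<or> dist q x < u" "r = a \<or> dist r x < u"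
      by force+
    have "dist p q \<le> dist p x + dist q x" "dist q r \<le> dist q x + dist r x"
      "dist p r \<le> dist p x + dist r x" by (rule dist_triangle2)+
    with * u assms show False by (smt (verit))
  qed
  have "\<exists>z\<in>{p,q,r}. z \<noteq> a \<and> z \<noteq> b" for a b
    using assms by auto
  thus ?thesis using u far unfolding test_points_def by (intro exI[of _ "{p,q,r}"] exI[of _ u]) auto
qed

section \<open>Subsequences and limits\<close>

lemma const_or_inj_subseq:
  fixes g :: "nat \<Rightarrow> 'a"
  obtains r c where "strict_mono (r :: nat \<Rightarrow> nat)" "\<And>n. g (r n) = c"
  | r where "strict_mono (r :: nat \<Rightarrow> nat)" "inj (g \<circ> r)"
proof (cases "finite (range g)")
  case True
  then obtain c where "infinite {n. g n = c}"
    using pigeonhole_infinite[of UNIV g] by auto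
  then obtain r where "strict_mono (r::nat\<Rightarrow>nat)" "\<forall>n. r n \<in> {n. g n = c}"
    using infinite_enumerate by blast
  thus thesis using that(1)[of r c] by simp
next
  case False
  \<comment> \<open>Indices of first occurrences: they realise every value of \<open>g\<close>, so
    there are infinitely many, and \<open>g\<close> is injective on them.\<close>
  define S where "S = {n. \<forall>m<n. g m \<noteq> g n}"
  have "g k \<in> g ` S" for k
  proof -
    define n where "n = (LEAST n. g n = g k)"
    have n: "g n = g k" unfolding n_def by (rule LeastI) (rule refl)
    moreover have "n \<in> S"
      unfolding S_def mem_Collect_eq n
      using not_less_Least[of _ "\<lambda>n. g n = g k", folded n_def] by blast
    ultimately show ?thesis by (metis image_eqI)
  qed
  hence "infinite S" using False by (metis finite_imageI finite_subset image_subsetI)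
  then obtain r where r: "strict_mono (r::nat\<Rightarrow>nat)" "\<And>n. r n \<in> S"
    using infinite_enumerate[of S] by auto
  have "inj (g \<circ> r)"
  proof (rule linorder_injI)
    fix x y :: nat assume "x < y"
    hence "r x < r y" using r(1) by (simp add: strict_mono_less)
    thus "(g \<circ> r) x \<noteq> (g \<circ> r) y" using r(2)[of y] by (auto simp: S_def)
  qed
  thus thesis using that(2) r(1) by blast
qed

lemma tendsto_if_dist_null:
  fixes X Y :: "nat \<Rightarrow> 'm::metric_space"
  assumes "(\<lambda>n. dist (X n) (Y n)) \<longlonglongrightarrow> 0" "X \<longlonglongrightarrow> l" shows "Y \<longlonglongrightarrow> l"
proof -
  have "(\<lambda>n. dist (X n) (Y n) + dist (X n) l) \<longlonglongrightarrow> 0"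
    using tendsto_add[OF assms(1) assms(2)[THEN tendsto_dist_iff[THEN iffD1]]] by simp
  hence "(\<lambda>n. dist (Y n) l) \<longlonglongrightarrow> 0"
    by (rule Lim_null_comparison[rotated]) (auto simp: dist_triangle3)
  thus ?thesis by (simp add: tendsto_dist_iff[of Y])
qed

lemma tendsto_if_dist_lt_inverse:
  fixes X Y :: "nat \<Rightarrow> 'm::metric_space"
  assumes "\<And>n. dist (X n) (Y n) < 1 / Suc n" "Y \<longlonglongrightarrow> l" shows "X \<longlonglongrightarrow> l"
proof (rule tendsto_if_dist_null[OF _ assms(2)])
  show "(\<lambda>n. dist (Y n) (X n)) \<longlonglongrightarrow> 0"
    by (rule Lim_null_comparison[OF _ LIMSEQ_Suc[OF lim_const_over_n[of 1]]])
      (use assms(1) in \<open>auto simp: dist_commute intro!: always_eventually less_imp_le\<close>)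
qed

lemma strict_mono_ident: "strict_mono (\<lambda>n::nat. n)"
  by (simp add: strict_mono_def)

section \<open>The action and its convergence sequences\<close>

locale three_point_convergence = group G for G :: "('g, 'c) monoid_scheme" (structure) +
  fixes \<phi> :: "'g \<Rightarrow> 'm::metric_space \<Rightarrow> 'm" and T :: "'m set" and u0 :: real
  assumes compact_M: "compact (UNIV :: 'm set)"
    and conv_action: "convergence_action G \<phi>"
    and sep: "test_points T u0"
begin

lemma finite_T: "finite T" and u0_pos: "u0 > 0"
  and third: "\<exists>p\<in>T. p \<noteq> a \<and> p \<noteq> b" and far: "\<exists>p\<in>T. p \<noteq> a \<and> u0 \<le> dist p x"
  using sep unfolding test_points_def by auto

lemma action: "group_action G UNIV \<phi>"
  using conv_action unfolding convergence_action_def homeo_action_def by auto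

lemma act_mult: "g \<in> carrier G \<Longrightarrow> h \<in> carrier G \<Longrightarrow> \<phi> (g \<otimes> h) x = \<phi> g (\<phi> h x)"
  using group_action.composition_rule[OF action, of x g h] by simp

lemma act_one [simp]: "\<phi> \<one> x = x"
  using group_action.id_eq_one[OF action] by (metis UNIV_I restrict_apply')

lemma act_inv [simp]: "g \<in> carrier G \<Longrightarrow> \<phi> (inv g) (\<phi> g x) = x"
  by (metis act_mult act_one inv_closed l_inv)

lemma act_inv' [simp]: "g \<in> carrier G \<Longrightarrow> \<phi> g (\<phi> (inv g) x) = x"
  by (metis act_mult act_one inv_closed r_inv)

lemma act_eq_iff [simp]: "g \<in> carrier G \<Longrightarrow> \<phi> g x = \<phi> g y \<longleftrightarrow> x = y"
  by (metis act_inv)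

lemma act_cont: "g \<in> carrier G \<Longrightarrow> continuous_on UNIV (\<phi> g)"
  using conv_action unfolding convergence_action_def homeo_action_def homeomorphism_def by auto

lemma act_tendsto: "g \<in> carrier G \<Longrightarrow> (f \<longlongrightarrow> x) F \<Longrightarrow> ((\<lambda>n. \<phi> g (f n)) \<longlongrightarrow> \<phi> g x) F"
  using continuous_on_tendsto_compose[OF act_cont, of g f x F] by simp

lemma subseq_lim:
  obtains r l where "strict_mono (r :: nat \<Rightarrow> nat)" "(\<lambda>n. (x (r n) :: 'm)) \<longlonglongrightarrow> l"
  using compact_M unfolding compact_eq_seq_compact_metric seq_compact_def comp_def
  by (metis UNIV_I)

text \<open>Locally uniform convergence off \<open>a\<close> in uniform form: the sets
  \<open>{x. r \<le> dist x a}\<close> are compact, so finitely many neighbourhoods from the local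
  definition cover each of them.\<close>

definition conv :: "(nat \<Rightarrow> 'g) \<Rightarrow> 'm \<Rightarrow> 'm \<Rightarrow> bool" where
  "conv g b a \<longleftrightarrow> range g \<subseteq> carrier G \<and>
     (\<forall>r>0. \<forall>e>0. \<forall>\<^sub>F n in sequentially. \<forall>x. r \<le> dist x a \<longrightarrow> dist (\<phi> (g n) x) b < e)"

lemma convD: "conv g b a \<Longrightarrow> r > 0 \<Longrightarrow> e > 0 \<Longrightarrow>
    \<forall>\<^sub>F n in sequentially. \<forall>x. r \<le> dist x a \<longrightarrow> dist (\<phi> (g n) x) b < e"
  unfolding conv_def by blast

lemma conv_closed: "conv g b a \<Longrightarrow> g n \<in> carrier G"
  unfolding conv_def by blast

lemma convergence_sequence_iff:
  assumes "H \<subseteq> carrier G"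
  shows "convergence_sequence \<phi> H g b a \<longleftrightarrow> range g \<subseteq> H \<and> conv g b a"
proof
  assume L: "convergence_sequence \<phi> H g b a"
  have "\<forall>\<^sub>F n in sequentially. \<forall>x. r \<le> dist x a \<longrightarrow> dist (\<phi> (g n) x) b < e"
    if "r > 0" "e > 0" for r e
  proof -
    define C where "C = {x. r \<le> dist x a}"
    have "closed C" unfolding C_def by (intro closed_Collect_le continuous_intros)
    hence C: "compact C" using compact_M closed_Int_compact[of C UNIV] by simp
    have "\<forall>x\<in>C. \<exists>V. open V \<and> x \<in> V \<and> uniform_limit V (\<lambda>n. \<phi> (g n)) (\<lambda>_. b) sequentially"
    proof
      fix x assume "x \<in> C"
      hence "x \<in> - {a}" using \<open>r > 0\<close> by (auto simp: C_def)
      thus "\<exists>V. open V \<and> x \<in> V \<and> uniform_limit V (\<lambda>n. \<phi> (g n)) (\<lambda>_. b) sequentially"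
        using L unfolding convergence_sequence_def by blast
    qed
    then obtain V where V: "\<And>x. x \<in> C \<Longrightarrow> open (V x) \<and> x \<in> V x
        \<and> uniform_limit (V x) (\<lambda>n. \<phi> (g n)) (\<lambda>_. b) sequentially" by metis
    obtain D where D: "D \<subseteq> C" "finite D" "C \<subseteq> (\<Union>x\<in>D. V x)"
      using compactE_image[OF C, of C V] V by blast
    have "\<forall>\<^sub>F n in sequentially. \<forall>x\<in>D. \<forall>z\<in>V x. dist (\<phi> (g n) z) b < e"
      using D V \<open>e > 0\<close> by (intro eventually_ball_finite) (auto simp: uniform_limit_iff)
    thus ?thesis by eventually_elim (use D in \<open>auto simp: C_def\<close>)
  qed
  thus "range g \<subseteq> H \<and> conv g b a" using L assms unfolding convergence_sequence_def conv_def by auto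
next
  assume R: "range g \<subseteq> H \<and> conv g b a"
  have "\<exists>V. open V \<and> x \<in> V \<and> V \<subseteq> - {a} \<and> uniform_limit V (\<lambda>n. \<phi> (g n)) (\<lambda>_. b) sequentially"
    if "x \<in> - {a}" for x
  proof (intro exI conjI)
    let ?V = "{z. dist x a / 2 < dist z a}"
    show "open ?V" by (intro open_Collect_less continuous_intros)
    show "x \<in> ?V" "?V \<subseteq> - {a}" using that by auto
    show "uniform_limit ?V (\<lambda>n. \<phi> (g n)) (\<lambda>_. b) sequentially"
      unfolding uniform_limit_iff
    proof safe
      fix e :: real assume "e > 0"
      have "\<forall>\<^sub>F n in sequentially. \<forall>z. dist x a / 2 \<le> dist z a \<longrightarrow> dist (\<phi> (g n) z) b < e"
        using R that \<open>e > 0\<close> by (intro convD) auto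
      thus "\<forall>\<^sub>F n in sequentially. \<forall>z\<in>?V. dist (\<phi> (g n) z) b < e"
        by eventually_elim auto
    qed
  qed
  thus "convergence_sequence \<phi> H g b a" using R unfolding convergence_sequence_def by blast
qed

lemma conv_subseq: "conv g b a \<Longrightarrow> strict_mono r \<Longrightarrow> conv (\<lambda>n. g (r n)) b a"
  unfolding conv_def
  by (auto simp: image_subset_iff intro: eventually_subseq[where r = r])

lemma conv_tendsto:
  assumes g: "conv g b a" and x: "x \<longlonglongrightarrow> l" "l \<noteq> a"
  shows "(\<lambda>n. \<phi> (g n) (x n)) \<longlonglongrightarrow> b"
proof (rule tendstoI)
  fix e :: real assume "e > 0"
  have "\<forall>\<^sub>F n in sequentially. dist (x n) l < dist l a / 2"
    using x by (intro tendstoD) auto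
  moreover have "\<forall>\<^sub>F n in sequentially. \<forall>z. dist l a / 2 \<le> dist z a \<longrightarrow> dist (\<phi> (g n) z) b < e"
    using x \<open>e > 0\<close> by (intro convD[OF g]) auto
  ultimately show "\<forall>\<^sub>F n in sequentially. dist (\<phi> (g n) (x n)) b < e"
  proof eventually_elim
    case (elim n)
    have "dist l a \<le> dist (x n) l + dist (x n) a" by (metis dist_commute dist_triangle)
    thus ?case using elim by auto
  qed
qed

lemma conv_T:
  assumes "conv g b a" "e > 0"
  shows "\<forall>\<^sub>F n in sequentially. \<forall>p\<in>T. p \<noteq> a \<longrightarrow> dist (\<phi> (g n) p) b < e"
proof (intro eventually_ball_finite finite_T ballI)
  fix p assume "p \<in> T"
  show "\<forall>\<^sub>F n in sequentially. p \<noteq> a \<longrightarrow> dist (\<phi> (g n) p) b < e"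
    using tendstoD[OF conv_tendsto[OF assms(1) tendsto_const[of p]] assms(2)]
    by (cases "p = a") auto
qed

text \<open>Contraposition: if \<open>g n\<close> sends everything at distance \<open>e\<close> or
  more from \<open>a\<close> into the \<open>r\<close>-ball about \<open>b\<close>, a point outside
  that ball has its preimage within \<open>e\<close> of \<open>a\<close>. Radius and tolerance
  change places.\<close>

lemma conv_inv: assumes g: "conv g b a" shows "conv (\<lambda>n. inv (g n)) a b"
  unfolding conv_def
proof (intro conjI allI impI)
  show "range (\<lambda>n. inv (g n)) \<subseteq> carrier G" using conv_closed[OF g] by auto
  fix r e :: real assume "r > 0" "e > 0"
  from convD[OF g \<open>e > 0\<close> \<open>r > 0\<close>]
  show "\<forall>\<^sub>F n in sequentially. \<forall>x. r \<le> dist x b \<longrightarrow> dist (\<phi> (inv (g n)) x) a < e"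
  proof eventually_elim
    case (elim n)
    show ?case
    proof (intro allI impI, rule ccontr)
      fix x assume "r \<le> dist x b" "\<not> dist (\<phi> (inv (g n)) x) a < e"
      thus False using elim[rule_format, of "\<phi> (inv (g n)) x"] conv_closed[OF g] by simp
    qed
  qed
qed

lemma act_unif:
  assumes f: "f \<in> carrier G" and "e > 0"
  shows "\<exists>d>0. \<forall>x y. dist x y < d \<longrightarrow> dist (\<phi> f x) (\<phi> f y) < e"
  using compact_uniformly_continuous[OF act_cont[OF f] compact_M] \<open>e > 0\<close>
  unfolding uniformly_continuous_on_def by (metis UNIV_I dist_commute)

lemma conv_left:
  assumes g: "conv g b a" and f: "f \<in> carrier G"
  shows "conv (\<lambda>n. f \<otimes> g n) (\<phi> f b) a"
  unfolding conv_def
proof (intro conjI allI impI)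
  show "range (\<lambda>n. f \<otimes> g n) \<subseteq> carrier G" using f conv_closed[OF g] by auto
  fix r e :: real assume "r > 0" "e > 0"
  obtain d where d: "d > 0" "\<And>x y. dist x y < d \<Longrightarrow> dist (\<phi> f x) (\<phi> f y) < e"
    using act_unif[OF f \<open>e > 0\<close>] by blast
  from convD[OF g \<open>r > 0\<close> \<open>d > 0\<close>]
  show "\<forall>\<^sub>F n in sequentially. \<forall>x. r \<le> dist x a \<longrightarrow> dist (\<phi> (f \<otimes> g n) x) (\<phi> f b) < e"
    by eventually_elim (use d f conv_closed[OF g] in \<open>auto simp: act_mult\<close>)
qed

lemma conv_right:
  assumes g: "conv g b a" and f: "f \<in> carrier G"
  shows "conv (\<lambda>n. g n \<otimes> inv f) b (\<phi> f a)"
proof -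
  have "conv (\<lambda>n. f \<otimes> inv (g n)) (\<phi> f a) b" by (rule conv_left[OF conv_inv[OF g] f])
  from conv_inv[OF this] have "conv (\<lambda>n. inv (f \<otimes> inv (g n))) b (\<phi> f a)" .
  moreover have "inv (f \<otimes> inv (g n)) = g n \<otimes> inv f" for n
    using f conv_closed[OF g, of n] by (simp add: inv_mult_group)
  ultimately show ?thesis by simp
qed

text \<open>The convergence property speaks of distinct elements only; a sequence with finite range
  has a constant subsequence instead. The limit arguments below split along these two cases.\<close>

lemma const_or_conv [consumes 1]:
  assumes "\<And>n. g n \<in> carrier G"
  obtains (const) r c where "strict_mono (r::nat\<Rightarrow>nat)" "\<And>n. g (r n) = c" "c \<in> carrier G"
  | (conv) r b a where "strict_mono (r::nat\<Rightarrow>nat)" "inj (\<lambda>n. g (r n))" "conv (\<lambda>n. g (r n)) b a"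
proof (cases rule: const_or_inj_subseq[of g])
  case (1 r c)
  thus thesis using const assms by metis
next
  case (2 r)
  have "range (g \<circ> r) \<subseteq> carrier G" using assms by auto
  then obtain s a b where s: "strict_mono s" "convergence_sequence \<phi> (carrier G) (g \<circ> r \<circ> s) b a"
    using conv_action 2 unfolding convergence_action_def by blast
  have "inj (\<lambda>n. g (r (s n)))"
    using inj_compose[OF 2(2) strict_mono_imp_inj_on[OF s(1)]] by (simp add: comp_def)
  moreover have "conv (\<lambda>n. g (r (s n))) b a"
    using s(2) by (simp add: convergence_sequence_iff comp_def)
  moreover have "strict_mono (\<lambda>n. r (s n))" using strict_mono_o[OF 2(1) s(1)] by (simp add: comp_def)
  ultimately show thesis using conv[of "\<lambda>n. r (s n)" b a] by blast
qed

lemma infinite_conv: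
  assumes "infinite S" "S \<subseteq> carrier G"
  obtains g b a where "\<And>n. g n \<in> S" "inj g" "conv g b a"
proof -
  obtain f :: "nat \<Rightarrow> 'g" where f: "inj f" "range f \<subseteq> S"
    using assms(1) infinite_countable_subset by blast
  hence fc: "f n \<in> carrier G" for n using assms by auto
  from fc show thesis
  proof (cases rule: const_or_conv[of f])
    case (const r c)
    thus thesis using f(1) by (metis inj_eq n_not_Suc_n strict_mono_eq)
  next
    case (conv r b a)
    thus thesis using that[of "\<lambda>n. f (r n)" b a] f(2) by auto
  qed
qed

lemma conv_attracting_unique:
  assumes "conv g b a" "conv g b' a'" shows "b = b'"
proof -
  obtain p where "p \<noteq> a" "p \<noteq> a'" using third by blast
  hence "(\<lambda>n. \<phi> (g n) p) \<longlonglongrightarrow> b" "(\<lambda>n. \<phi> (g n) p) \<longlonglongrightarrow> b'"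
    using assms conv_tendsto[OF _ tendsto_const[of p]] by auto
  thus ?thesis by (rule LIMSEQ_unique)
qed

lemma conv_if_subseq:
  assumes g: "\<And>n. g n \<in> carrier G"
    and *: "\<And>r. strict_mono (r::nat\<Rightarrow>nat) \<Longrightarrow> \<exists>s. strict_mono (s::nat\<Rightarrow>nat) \<and> conv (\<lambda>n. g (r (s n))) b a"
  shows "conv g b a"
  unfolding conv_def
proof (intro conjI allI impI)
  show "range g \<subseteq> carrier G" using g by auto
  fix \<rho> e :: real assume pos: "\<rho> > 0" "e > 0"
  let ?P = "\<lambda>n. \<forall>x. \<rho> \<le> dist x a \<longrightarrow> dist (\<phi> (g n) x) b < e"
  show "eventually ?P sequentially"
  proof (rule ccontr)
    assume "\<not> eventually ?P sequentially"
    hence "infinite {n. \<not> ?P n}"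
      unfolding eventually_sequentially infinite_nat_iff_unbounded_le by auto
    then obtain r where r: "strict_mono (r::nat\<Rightarrow>nat)" "\<And>n. \<not> ?P (r n)"
      using infinite_enumerate[of "{n. \<not> ?P n}"] by auto
    obtain s where "strict_mono s" "conv (\<lambda>n. g (r (s n))) b a" using *[OF r(1)] by auto
    from eventually_happens[OF convD[OF this(2) pos]] r(2) show False by auto
  qed
qed

text \<open>Sequences with limits off the repelling point are squeezed together. A lower bound on
  the distance of the images therefore puts one of the two limits at the repelling point.\<close>

lemma conv_triple:
  assumes "conv g b a" "x \<longlonglongrightarrow> x'" "y \<longlonglongrightarrow> y'" "x' \<noteq> a" "y' \<noteq> a" "e > 0"
  shows "\<forall>\<^sub>F n in sequentially. dist (\<phi> (g n) (x n)) (\<phi> (g n) (y n)) < e"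
  using tendstoD[OF tendsto_dist[OF conv_tendsto[OF assms(1,2,4)] conv_tendsto[OF assms(1,3,5)]] assms(6)]
  by simp

section \<open>Limit set and conical points\<close>

abbreviation \<Lambda> :: "'m set" where "\<Lambda> \<equiv> limit_set \<phi> (carrier G)"

lemma convergence_sequence_carrier:
  "convergence_sequence \<phi> (carrier G) g b a \<longleftrightarrow> conv g b a"
  using convergence_sequence_iff[OF subset_refl] unfolding conv_def by blast

lemma limit_set_iff: "b \<in> \<Lambda> \<longleftrightarrow> (\<exists>g a. conv g b a)"
  unfolding limit_set_def convergence_sequence_carrier by auto

lemma limit_set_act: "b \<in> \<Lambda> \<Longrightarrow> f \<in> carrier G \<Longrightarrow> \<phi> f b \<in> \<Lambda>"
  unfolding limit_set_iff using conv_left by blast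

text \<open>Diagonal argument: choose \<open>g n\<close> sending the complement of the
  \<open>1 / Suc n\<close>-ball about some \<open>a n\<close> that close to \<open>x n\<close>.
  Where \<open>a n\<close> converges to \<open>a'\<close>, every point other than \<open>a'\<close>
  is sent to \<open>b\<close> in the limit, so \<open>b\<close> is the attracting point of a
  convergence subsequence.\<close>

lemma limit_set_limit:
  assumes "\<And>n. x n \<in> \<Lambda>" "x \<longlonglongrightarrow> b" shows "b \<in> \<Lambda>"
proof -
  have "\<exists>g a. g \<in> carrier G \<and> (\<forall>z. 1 / Suc n \<le> dist z a \<longrightarrow> dist (\<phi> g z) (x n) < 1 / Suc n)" for n
  proof -
    obtain f a where f: "conv f (x n) a" using assms(1) limit_set_iff by blast
    have "\<forall>\<^sub>F k in sequentially. \<forall>z. 1 / Suc n \<le> dist z a \<longrightarrow> dist (\<phi> (f k) z) (x n) < 1 / Suc n"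
      by (rule convD[OF f]) auto
    thus ?thesis using eventually_happens[of _ sequentially] conv_closed[OF f] by fastforce
  qed
  then obtain g a where g: "\<And>n. g n \<in> carrier G"
    and action: "\<And>n z. 1 / Suc n \<le> dist z (a n) \<Longrightarrow> dist (\<phi> (g n) z) (x n) < 1 / Suc n"
    by metis
  obtain r0 a' where r0: "strict_mono (r0::nat\<Rightarrow>nat)" "(\<lambda>n. a (r0 n)) \<longlonglongrightarrow> a'" by (rule subseq_lim)
  have lim: "(\<lambda>n. \<phi> (g (r0 n)) z) \<longlonglongrightarrow> b" if "z \<noteq> a'" for z
  proof -
    have i: "(\<lambda>n. 1 / real (Suc (r0 n))) \<longlonglongrightarrow> 0"
      using LIMSEQ_subseq_LIMSEQ[OF LIMSEQ_Suc[OF lim_const_over_n[of 1]] r0(1)] by (simp add: comp_def)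
    have "(\<lambda>n. dist z (a (r0 n))) \<longlonglongrightarrow> dist z a'" by (intro tendsto_intros r0)
    hence "\<forall>\<^sub>F n in sequentially. dist z a' / 2 < dist z (a (r0 n))"
      using that by (intro order_tendstoD) auto
    moreover have "\<forall>\<^sub>F n in sequentially. 1 / Suc (r0 n) < dist z a' / 2"
      using i that by (intro order_tendstoD) auto
    ultimately have ev: "\<forall>\<^sub>F n in sequentially. norm (dist (\<phi> (g (r0 n)) z) (x (r0 n))) \<le> 1 / Suc (r0 n)"
    proof eventually_elim
      case (elim n)
      thus ?case using action[of "r0 n" z] by simp
    qed
    have "(\<lambda>n. dist (x (r0 n)) (\<phi> (g (r0 n)) z)) \<longlonglongrightarrow> 0"
      using Lim_null_comparison[OF ev i] by (simp add: dist_commute)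
    moreover have "(\<lambda>n. x (r0 n)) \<longlonglongrightarrow> b"
      using LIMSEQ_subseq_LIMSEQ[OF assms(2) r0(1)] by (simp add: comp_def)
    ultimately show ?thesis by (rule tendsto_if_dist_null)
  qed
  obtain p where p: "p \<noteq> a'" using third by blast
  have gr: "\<And>n. g (r0 n) \<in> carrier G" using g by auto
  from gr show ?thesis
  proof (cases rule: const_or_conv[of "\<lambda>n. g (r0 n)"])
    case (const r c)
    \<comment> \<open>A constant subsequence would send both \<open>p\<close> and \<open>q\<close>
      to \<open>b\<close>, against injectivity.\<close>
    have "\<phi> c z = b" if "z \<noteq> a'" for z
      using LIMSEQ_subseq_LIMSEQ[OF lim[OF that] const(1)] const(2)
      by (simp add: comp_def LIMSEQ_const_iff)
    moreover obtain q where "q \<noteq> a'" "q \<noteq> p" using third by blast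
    ultimately show ?thesis using p const(3) act_eq_iff by metis
  next
    case (conv r b'' a'')
    obtain q where q: "q \<noteq> a'" "q \<noteq> a''" using third by blast
    have "(\<lambda>n. \<phi> (g (r0 (r n))) q) \<longlonglongrightarrow> b''"
      using conv_tendsto[OF conv(3) tendsto_const[of q]] q by simp
    moreover have "(\<lambda>n. \<phi> (g (r0 (r n))) q) \<longlonglongrightarrow> b"
      using LIMSEQ_subseq_LIMSEQ[OF lim[OF q(1)] conv(1)] by (simp add: comp_def)
    ultimately have "b'' = b" by (rule LIMSEQ_unique)
    thus ?thesis using conv(3) limit_set_iff by blast
  qed
qed

lemma closed_limit_set: "closed \<Lambda>"
  unfolding closed_sequential_limits using limit_set_limit by blast

lemma conical_iff:
  "conical G \<phi> \<xi> \<longleftrightarrow> (\<exists>g b c. conv g b \<xi> \<and> (\<lambda>n. \<phi> (g n) \<xi>) \<longlonglongrightarrow> c \<and> c \<noteq> b)"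
  unfolding conical_def convergence_sequence_carrier by blast

lemma stabilizer_subset: "stabilizer G \<phi> \<xi> \<subseteq> carrier G"
  unfolding stabilizer_def by auto

lemma limit_set_stabilizer_iff:
  "b \<in> limit_set \<phi> (stabilizer G \<phi> \<xi>) \<longleftrightarrow>
     (\<exists>g a. conv g b a \<and> (\<forall>n. \<phi> (g n) \<xi> = \<xi>))"
  unfolding limit_set_def convergence_sequence_iff[OF stabilizer_subset] conv_def
  by (auto simp: stabilizer_def)

text \<open>If the images of \<open>\<xi>\<close> stayed away from \<open>\<beta>\<close> along a
  subsequence, compactness would give them a limit other than \<open>\<beta>\<close>; with
  \<open>\<xi>\<close> repelling this is conicality.\<close>

lemma nonconical_tendsto:
  assumes nc: "\<not> conical G \<phi> \<xi>" and g: "conv g \<beta> \<alpha>"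
  shows "(\<lambda>n. \<phi> (g n) \<xi>) \<longlonglongrightarrow> \<beta>"
proof (cases "\<alpha> = \<xi>")
  case False
  thus ?thesis using conv_tendsto[OF g tendsto_const[of \<xi>]] by auto
next
  case True
  show ?thesis
  proof (rule tendstoI, rule ccontr)
    fix e :: real assume e: "e > 0" "\<not> (\<forall>\<^sub>F n in sequentially. dist (\<phi> (g n) \<xi>) \<beta> < e)"
    hence "infinite {n. e \<le> dist (\<phi> (g n) \<xi>) \<beta>}"
      unfolding eventually_sequentially infinite_nat_iff_unbounded_le by (auto simp: not_less)
    then obtain r where "strict_mono (r::nat\<Rightarrow>nat)" "\<forall>n. r n \<in> {n. e \<le> dist (\<phi> (g n) \<xi>) \<beta>}"
      using infinite_enumerate by blast
    hence r: "strict_mono r" "\<And>n. e \<le> dist (\<phi> (g (r n)) \<xi>) \<beta>" by auto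
    obtain s c where s: "strict_mono (s::nat\<Rightarrow>nat)" "(\<lambda>n. \<phi> (g (r (s n))) \<xi>) \<longlonglongrightarrow> c"
      using subseq_lim[of "\<lambda>n. \<phi> (g (r n)) \<xi>"] by metis
    have "e \<le> dist c \<beta>"
      using tendsto_dist[OF s(2) tendsto_const[of \<beta>]] r(2) by (intro LIMSEQ_le_const) auto
    hence "c \<noteq> \<beta>" using e(1) by auto
    thus False
      using nc conv_subseq[OF conv_subseq[OF g r(1)] s(1)] s(2) True unfolding conical_iff by blast
  qed
qed

lemma conical_act:
  assumes k: "k \<in> carrier G" and "conical G \<phi> (\<phi> k \<xi>)" shows "conical G \<phi> \<xi>"
proof -
  obtain g b c where g: "conv g b (\<phi> k \<xi>)" "(\<lambda>n. \<phi> (g n) (\<phi> k \<xi>)) \<longlonglongrightarrow> c" "c \<noteq> b"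
    using assms(2) unfolding conical_iff by blast
  have "conv (\<lambda>n. g n \<otimes> k) b \<xi>" using conv_right[OF g(1), of "inv k"] k by simp
  moreover have "\<phi> (g n \<otimes> k) \<xi> = \<phi> (g n) (\<phi> k \<xi>)" for n using conv_closed[OF g(1)] k by (simp add: act_mult)
  ultimately show ?thesis unfolding conical_iff using g by (intro exI[of _ "\<lambda>n. g n \<otimes> k"]) auto
qed

subsection \<open>Hyperbolic elements\<close>

lemma pow_mono_comm: "\<gamma> \<in> carrier G \<Longrightarrow> \<phi> (\<gamma> [^] (n::nat)) (\<phi> \<gamma> x) = \<phi> \<gamma> (\<phi> (\<gamma> [^] n) x)"
  by (metis act_mult nat_pow_Suc nat_pow_Suc2 nat_pow_closed)

lemma act_pow_Suc: "\<gamma> \<in> carrier G \<Longrightarrow> \<phi> (\<gamma> [^] Suc n) x = \<phi> \<gamma> (\<phi> (\<gamma> [^] n) x)"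
  by (simp add: act_mult pow_mono_comm)

lemma act_pow_fixed: "\<gamma> \<in> carrier G \<Longrightarrow> \<phi> \<gamma> x = x \<Longrightarrow> \<phi> (\<gamma> [^] (n::nat)) x = x"
  by (induction n) (simp_all add: act_mult)

text \<open>\<open>\<gamma>\<close> commutes with its powers, so the powers carry
  \<open>\<phi> \<gamma> x\<close> both to \<open>b\<close> and to \<open>\<phi> \<gamma> b\<close>,
  once \<open>x\<close> is chosen such that \<open>x\<close> and \<open>\<phi> \<gamma> x\<close>
  avoid \<open>a\<close>.\<close>

lemma powers_attracting_fixed:
  assumes g: "\<gamma> \<in> carrier G" and c: "conv (\<lambda>n. \<gamma> [^] (r n :: nat)) b a"
  shows "\<phi> \<gamma> b = b"
proof -
  obtain x where x: "x \<noteq> a" "x \<noteq> \<phi> (inv \<gamma>) a" using third by blast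
  hence "\<phi> \<gamma> x \<noteq> a" using g by (metis act_inv)
  hence "(\<lambda>n. \<phi> (\<gamma> [^] r n) (\<phi> \<gamma> x)) \<longlonglongrightarrow> b"
    using conv_tendsto[OF c tendsto_const] by blast
  hence "(\<lambda>n. \<phi> \<gamma> (\<phi> (\<gamma> [^] r n) x)) \<longlonglongrightarrow> b" using g by (simp add: pow_mono_comm)
  moreover have "(\<lambda>n. \<phi> \<gamma> (\<phi> (\<gamma> [^] r n) x)) \<longlonglongrightarrow> \<phi> \<gamma> b"
    using x by (intro act_tendsto g conv_tendsto[OF c tendsto_const])
  ultimately show ?thesis by (rule LIMSEQ_unique[symmetric])
qed

lemma powers_inv:
  assumes g: "\<gamma> \<in> carrier G" and c: "conv (\<lambda>n. \<gamma> [^] (r n :: nat)) b a"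
  shows "conv (\<lambda>n. (inv \<gamma>) [^] (r n)) a b"
  using conv_inv[OF c] g by (simp add: nat_pow_inv)

lemma powers_fixed:
  assumes g: "\<gamma> \<in> carrier G" and c: "conv (\<lambda>n. \<gamma> [^] (r n :: nat)) b a"
  shows "invariants UNIV \<phi> \<gamma> = {b, a}"
proof -
  have "\<phi> \<gamma> b = b" using powers_attracting_fixed[OF g c] .
  moreover have "\<phi> (inv \<gamma>) a = a" using powers_attracting_fixed[OF _ powers_inv[OF g c]] g by simp
  hence "\<phi> \<gamma> a = a" using g by (metis act_inv')
  moreover have "x = b" if "\<phi> \<gamma> x = x" "x \<noteq> a" for x
  proof -
    have "(\<lambda>n. \<phi> (\<gamma> [^] r n) x) \<longlonglongrightarrow> b" using that by (intro conv_tendsto[OF c tendsto_const])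
    thus ?thesis using act_pow_fixed[OF g that(1)] by (simp add: LIMSEQ_const_iff)
  qed
  ultimately show ?thesis unfolding invariants_def by auto
qed

text \<open>The \<open>e\<close>-balls about \<open>a\<close> and \<open>b\<close> are disjoint, so
  the ball about \<open>b\<close> lies in the region that \<open>f\<close> contracts, and iteration
  never leaves it.\<close>

lemma iterate_contraction:
  assumes f: "f \<in> carrier G" and c: "\<And>x. e \<le> dist x a \<Longrightarrow> dist (\<phi> f x) b < e"
    and e: "2 * e \<le> dist a b" and p: "e \<le> dist p a" and "0 < k"
  shows "dist (\<phi> (f [^] (k::nat)) p) b < e"
  using \<open>0 < k\<close>
proof (induction k)
  case (Suc k)
  have "e \<le> dist (\<phi> (f [^] k) p) a"
  proof (cases "k = 0")
    case True thus ?thesis using p by simp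
  next
    case False
    hence "dist (\<phi> (f [^] k) p) b < e" using Suc by simp
    thus ?thesis using e dist_triangle3[of a b "\<phi> (f [^] k) p"] by (simp add: dist_commute)
  qed
  thus ?case using c unfolding act_pow_Suc[OF f] by blast
qed simp

text \<open>One power of \<open>\<gamma>\<close> contracts towards \<open>b\<close> and another
  towards \<open>a\<close>. Their common power, with exponent the product, would send
  \<open>p\<close> close to both.\<close>

lemma powers_not_reversed:
  assumes g: "\<gamma> \<in> carrier G" and "a \<noteq> b"
    and c: "conv (\<lambda>n. \<gamma> [^] (r n :: nat)) b a" "conv (\<lambda>n. \<gamma> [^] (s n :: nat)) a b"
  shows False
proof -
  obtain p where p: "p \<noteq> a" "p \<noteq> b" using third by blast
  define e where "e = min (min (dist p a) (dist p b)) (dist a b / 2)"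
  have e: "e > 0" "e \<le> dist p a" "e \<le> dist p b" "2 * e \<le> dist a b" "2 * e \<le> dist b a"
    using p \<open>a \<noteq> b\<close> by (auto simp: e_def dist_commute)
  obtain n where n: "\<And>x. e \<le> dist x a \<Longrightarrow> dist (\<phi> (\<gamma> [^] r n) x) b < e"
    using eventually_happens[OF convD[OF c(1) e(1) e(1)]] by auto
  obtain m where m: "\<And>x. e \<le> dist x b \<Longrightarrow> dist (\<phi> (\<gamma> [^] s m) x) a < e"
    using eventually_happens[OF convD[OF c(2) e(1) e(1)]] by auto
  have pos: "r n > 0" "s m > 0"
    using n[of p] m[of p] e by (auto intro!: Nat.gr0I)
  have "dist (\<phi> ((\<gamma> [^] r n) [^] s m) p) b < e" "dist (\<phi> ((\<gamma> [^] s m) [^] r n) p) a < e"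
    using iterate_contraction[OF _ n e(4) e(2) pos(2)] iterate_contraction[OF _ m e(5) e(3) pos(1)] g by auto
  hence "dist (\<phi> (\<gamma> [^] (r n * s m)) p) b < e" "dist (\<phi> (\<gamma> [^] (r n * s m)) p) a < e"
    using g by (simp_all add: nat_pow_pow mult.commute)
  thus False using e(4) dist_triangle3[of a b "\<phi> (\<gamma> [^] (r n * s m)) p"] by simp
qed

lemma ord_0_subseq_conv:
  assumes g: "\<gamma> \<in> carrier G" "ord \<gamma> = 0" and r: "strict_mono (r :: nat \<Rightarrow> nat)"
  obtains s b a where "strict_mono (s :: nat \<Rightarrow> nat)" "conv (\<lambda>n. \<gamma> [^] (r (s n))) b a"
proof -
  have inj: "m = n" if "\<gamma> [^] m = \<gamma> [^] n" for m n :: nat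
  proof -
    have *: "\<not> i < j" if "\<gamma> [^] i = \<gamma> [^] j" for i j :: nat
    proof
      assume ij: "i < j"
      have "\<gamma> [^] i \<otimes> \<gamma> [^] (j - i) = \<gamma> [^] i"
        using nat_pow_mult[OF g(1), of i "j - i"] that ij by simp
      hence "\<gamma> [^] (j - i) = \<one>" using g(1) l_cancel_one by simp
      thus False using g ij ord_eq_0[OF g(1)] by simp
    qed
    from *[of m n] *[of n m] that show ?thesis by simp
  qed
  have cl: "\<And>n. \<gamma> [^] r n \<in> carrier G" using g by simp
  from cl show thesis
  proof (cases rule: const_or_conv[of "\<lambda>n. \<gamma> [^] r n"])
    case (const s c)
    hence "\<gamma> [^] r (s 0) = \<gamma> [^] r (s 1)" by simp
    hence "s 0 = s 1" using inj r strict_mono_eq by metis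
    thus ?thesis using const(1) by (simp add: strict_mono_eq)
  next
    case (conv s b a)
    thus ?thesis using that by blast
  qed
qed

text \<open>Every subsequence of the powers has a further convergence subsequence, whose two points
  are the fixed points of \<open>\<gamma>\<close>. They cannot occur in exchanged roles, so the
  whole sequence converges.\<close>

lemma hyperbolic_powers:
  assumes "hyperbolic G \<phi> \<gamma>"
  obtains b a where "b \<noteq> a" "invariants UNIV \<phi> \<gamma> = {b, a}" "conv (\<lambda>n. \<gamma> [^] (n::nat)) b a"
proof -
  have g: "\<gamma> \<in> carrier G" "ord \<gamma> = 0" "card (invariants UNIV \<phi> \<gamma>) = 2"
    using assms unfolding hyperbolic_def by auto
  obtain s :: "nat \<Rightarrow> nat" and b a where "strict_mono s" and s: "conv (\<lambda>n. \<gamma> [^] (s n)) b a"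
    by (rule ord_0_subseq_conv[OF g(1,2) strict_mono_ident])
  have F: "invariants UNIV \<phi> \<gamma> = {b, a}" using powers_fixed[OF g(1) s] .
  hence ne: "b \<noteq> a" using g(3) by (auto simp: card_insert_if split: if_splits)
  have "conv (\<lambda>n. \<gamma> [^] n) b a"
  proof (rule conv_if_subseq)
    fix r :: "nat \<Rightarrow> nat" assume "strict_mono r"
    then obtain t :: "nat \<Rightarrow> nat" and b' a' where t: "strict_mono t" "conv (\<lambda>n. \<gamma> [^] (r (t n))) b' a'"
      by (rule ord_0_subseq_conv[OF g(1,2)])
    have "{b', a'} = {b, a}" using powers_fixed[OF g(1) t(2)] F by simp
    moreover have "\<not> (b' = a \<and> a' = b)" using powers_not_reversed[OF g(1) _ s, of "\<lambda>n. r (t n)"] t ne by auto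
    ultimately have "b' = b \<and> a' = a" by (auto simp: doubleton_eq_iff)
    thus "\<exists>s. strict_mono s \<and> conv (\<lambda>n. \<gamma> [^] r (s n)) b a" using t by blast
  qed (use g in simp)
  thus thesis using that ne F by blast
qed

lemma hyperbolic_fixed_points:
  assumes h: "hyperbolic G \<phi> \<gamma>"
  defines "b \<equiv> attracting_fixed_point G \<phi> \<gamma>" and "a \<equiv> repelling_fixed_point G \<phi> \<gamma>"
  shows "b \<noteq> a" "invariants UNIV \<phi> \<gamma> = {b, a}" "conv (\<lambda>n. \<gamma> [^] (n::nat)) b a"
proof -
  obtain b' a' where *: "b' \<noteq> a'" "invariants UNIV \<phi> \<gamma> = {b', a'}" "conv (\<lambda>n. \<gamma> [^] (n::nat)) b' a'"
    using hyperbolic_powers[OF h] by blast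
  have "b = b'"
    unfolding b_def attracting_fixed_point_def convergence_sequence_carrier
    using * conv_attracting_unique by (intro the_equality) auto
  moreover have "a = a'"
    unfolding a_def repelling_fixed_point_def convergence_sequence_carrier
    using * conv_attracting_unique by (intro the_equality) (auto simp: doubleton_eq_iff)
  ultimately show "b \<noteq> a" "invariants UNIV \<phi> \<gamma> = {b, a}" "conv (\<lambda>n. \<gamma> [^] (n::nat)) b a"
    using * by auto
qed

lemma contraction_attracting:
  assumes g: "\<gamma> \<in> carrier G" and c: "\<And>x. e \<le> dist x \<eta> \<Longrightarrow> dist (\<phi> \<gamma> x) \<theta> < e"
    and e: "0 < e" "2 * e < dist \<eta> \<theta>" and p: "e \<le> dist p \<eta>" "e \<le> dist p \<theta>"
    and r: "strict_mono (r :: nat \<Rightarrow> nat)" "conv (\<lambda>n. \<gamma> [^] (r n)) b a"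
  shows "dist b \<theta> \<le> e"
proof -
  have "p \<noteq> \<theta>" using e p by auto
  moreover have "e \<le> dist \<theta> \<eta>" using e by (simp add: dist_commute)
  \<comment> \<open>Both \<open>p\<close> and \<open>\<theta>\<close> lie outside the
    \<open>e\<close>-ball about \<open>\<eta>\<close>, and they differ, so one of them is not
    \<open>a\<close>.\<close>
  ultimately obtain x where x: "x \<noteq> a" "e \<le> dist x \<eta>" using p by metis
  have "(\<lambda>n. dist (\<phi> (\<gamma> [^] r n) x) \<theta>) \<longlonglongrightarrow> dist b \<theta>"
    using x(1) by (intro tendsto_intros conv_tendsto[OF r(2) tendsto_const])
  moreover have le: "dist (\<phi> (\<gamma> [^] r n) x) \<theta> \<le> e" if "n \<ge> 1" for n
    using iterate_contraction[OF g c _ x(2), where k = "r n"] e strict_mono_imp_increasing[OF r(1), of n] that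
    by (auto simp: less_imp_le)
  ultimately show ?thesis by (intro LIMSEQ_le_const2) blast+
qed

text \<open>The iterates of \<open>p\<close> stay near \<open>\<theta>\<close> while
  \<open>p\<close> does not, so no positive power is trivial. The attracting point of the powers is
  then near \<open>\<theta>\<close>; the same argument for the inverse places the repelling one near
  \<open>\<eta>\<close>.\<close>

lemma contraction_hyperbolic:
  assumes g: "\<gamma> \<in> carrier G" and c: "\<And>x. e \<le> dist x \<eta> \<Longrightarrow> dist (\<phi> \<gamma> x) \<theta> < e"
    and e: "0 < e" "2 * e < dist \<eta> \<theta>" and p: "e \<le> dist p \<eta>" "e \<le> dist p \<theta>"
  shows "hyperbolic G \<phi> \<gamma>" "dist (attracting_fixed_point G \<phi> \<gamma>) \<theta> \<le> e"
    "dist (repelling_fixed_point G \<phi> \<gamma>) \<eta> \<le> e"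
proof -
  have ci: "dist (\<phi> (inv \<gamma>) x) \<eta> < e" if "e \<le> dist x \<theta>" for x
    using c[of "\<phi> (inv \<gamma>) x"] g that by (force simp: not_less)
  have e': "2 * e < dist \<theta> \<eta>" using e by (simp add: dist_commute)
  have both: "dist b \<theta> \<le> e \<and> dist a \<eta> \<le> e"
    if r: "strict_mono (r :: nat \<Rightarrow> nat)" "conv (\<lambda>n. \<gamma> [^] (r n)) b a" for r b a
    using contraction_attracting[OF g c e p r]
      contraction_attracting[OF _ ci e(1) e' p(2,1) r(1) powers_inv[OF g r(2)]] g by auto
  have "\<gamma> [^] n \<noteq> \<one>" if "n \<noteq> 0" for n :: nat
    using iterate_contraction[OF g c _ p(1), where k = n] e p(2) that by auto
  hence ord: "ord \<gamma> = 0" using ord_eq_0[OF g] by auto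
  obtain s :: "nat \<Rightarrow> nat" and b a where s: "strict_mono s" "conv (\<lambda>n. \<gamma> [^] (s n)) b a"
    by (rule ord_0_subseq_conv[OF g ord strict_mono_ident])
  have "b \<noteq> a"
    using both[OF s] e dist_triangle3[of \<eta> \<theta> a] by auto
  thus h: "hyperbolic G \<phi> \<gamma>"
    unfolding hyperbolic_def using g ord powers_fixed[OF g s(2)] by simp
  show "dist (attracting_fixed_point G \<phi> \<gamma>) \<theta> \<le> e" "dist (repelling_fixed_point G \<phi> \<gamma>) \<eta> \<le> e"
    using both[OF _ hyperbolic_fixed_points(3)[OF h]] by (auto simp: strict_mono_def)
qed

lemma conv_eventually_hyperbolic:
  assumes f: "conv f \<theta> \<eta>" and ne: "\<theta> \<noteq> \<eta>" and "d > 0"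
  shows "\<forall>\<^sub>F n in sequentially. hyperbolic G \<phi> (f n) \<and> dist (attracting_fixed_point G \<phi> (f n)) \<theta> < d
    \<and> dist (repelling_fixed_point G \<phi> (f n)) \<eta> < d"
proof -
  obtain p where p: "p \<noteq> \<eta>" "p \<noteq> \<theta>" using third by blast
  \<comment> \<open>Leaves \<open>p\<close> outside both balls, keeps the balls disjoint with strict
    inequality, and makes the bounds \<open>\<le> e\<close> strict bounds by
    \<open>d\<close>.\<close>
  define e where "e = min (d/2) (min (min (dist p \<eta>) (dist p \<theta>)) (dist \<eta> \<theta> / 3))"
  have pos: "dist \<eta> \<theta> > 0" "dist p \<eta> > 0" "dist p \<theta> > 0" using ne p by simp_all
  have "e \<le> d/2" "e \<le> dist p \<eta>" "e \<le> dist p \<theta>" "e \<le> dist \<eta> \<theta> / 3" unfolding e_def by auto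
  moreover have "e > 0" using pos \<open>d > 0\<close> unfolding e_def by (simp del: zero_less_dist_iff)
  ultimately have e: "e > 0" "e < d" "e \<le> dist p \<eta>" "e \<le> dist p \<theta>" "2 * e < dist \<eta> \<theta>"
    using pos(1) \<open>d > 0\<close> by linarith+
  from convD[OF f e(1) e(1)] show ?thesis
  proof eventually_elim
    case (elim n)
    have "\<And>x. e \<le> dist x \<eta> \<Longrightarrow> dist (\<phi> (f n) x) \<theta> < e" using elim by blast
    from contraction_hyperbolic[OF conv_closed[OF f] this e(1,5,3,4)] e(2) show ?case by auto
  qed
qed

lemma hyperbolic_fixed_points_limit_set:
  assumes "hyperbolic G \<phi> \<gamma>"
  shows "attracting_fixed_point G \<phi> \<gamma> \<in> \<Lambda>" "repelling_fixed_point G \<phi> \<gamma> \<in> \<Lambda>"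
  using hyperbolic_fixed_points(3)[OF assms] conv_inv limit_set_iff by blast+

lemma dist_le_SUP:
  assumes "h \<in> carrier G"
  shows "dist (\<phi> h x) (\<phi> h y) \<le> (SUP h\<in>carrier G. dist (\<phi> h x) (\<phi> h y))"
proof -
  obtain B where "\<And>x y :: 'm. dist x y \<le> B"
    using compact_imp_bounded[OF compact_M] unfolding bounded_two_points by auto
  hence "bdd_above ((\<lambda>h. dist (\<phi> h x) (\<phi> h y)) ` carrier G)" by (intro bdd_aboveI2)
  thus ?thesis using assms by (rule cSUP_upper[rotated])
qed

text \<open>The powers of \<open>\<gamma>\<close> carry \<open>z\<close> from near \<open>a\<close>
  to near \<open>b\<close>. Under a translate keeping \<open>a\<close> and \<open>b\<close> apart,
  the last position before the orbit first comes \<open>\<delta> / 3\<close>-close to the image of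
  \<open>b\<close> is the required one.\<close>

lemma axis_crossing:
  assumes \<gamma>: "\<gamma> \<in> carrier G" "conv (\<lambda>n. \<gamma> [^] (n::nat)) b a" and h: "h \<in> carrier G"
    and \<delta>: "\<delta> > 0" "\<delta> \<le> dist (\<phi> h b) (\<phi> h a)" and z: "z \<noteq> a" "z \<noteq> b"
  obtains g where "g \<in> carrier G" "\<delta> \<le> dist (\<phi> g b) (\<phi> g a)" "\<delta> / 3 \<le> dist (\<phi> g z) (\<phi> g b)"
    "dist (\<phi> g (\<phi> \<gamma> z)) (\<phi> g b) < \<delta> / 3"
proof -
  have "b \<in> invariants UNIV \<phi> \<gamma>" "a \<in> invariants UNIV \<phi> \<gamma>" using powers_fixed[OF \<gamma>] by auto
  hence fixed: "\<phi> \<gamma> b = b" "\<phi> \<gamma> a = a" unfolding invariants_def by auto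
  hence fixed': "\<phi> (inv \<gamma>) b = b" "\<phi> (inv \<gamma>) a = a" using \<gamma>(1) by (metis act_inv)+
  have "(\<lambda>n. \<phi> h (\<phi> (inv \<gamma> [^] n) z)) \<longlonglongrightarrow> \<phi> h a"
    using z by (intro act_tendsto[OF h] conv_tendsto[OF powers_inv[OF \<gamma>] tendsto_const])
  from eventually_happens[OF tendstoD[OF this, of "\<delta> / 3"]] \<delta>(1)
  obtain M where M: "dist (\<phi> h (\<phi> (inv \<gamma> [^] (M::nat)) z)) (\<phi> h a) < \<delta> / 3" by auto
  \<comment> \<open>Precomposing with a negative power starts the orbit near the image of
    \<open>a\<close>, so the first entrance time \<open>m\<close> below is not
    \<open>0\<close>.\<close>
  define h' where "h' = h \<otimes> inv \<gamma> [^] M"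
  have h': "h' \<in> carrier G" "\<phi> h' b = \<phi> h b" "\<phi> h' a = \<phi> h a" "\<phi> h' z = \<phi> h (\<phi> (inv \<gamma> [^] M) z)"
    using h \<gamma>(1) fixed' by (simp_all add: h'_def act_mult act_pow_fixed)
  have M': "\<delta> / 3 \<le> dist (\<phi> h' z) (\<phi> h b)"
    using M \<delta> h'(4) dist_triangle3[of "\<phi> h b" "\<phi> h a" "\<phi> h' z"] by simp
  define P where "P m \<longleftrightarrow> dist (\<phi> h' (\<phi> (\<gamma> [^] m) z)) (\<phi> h b) < \<delta> / 3" for m :: nat
  have "(\<lambda>n. \<phi> h' (\<phi> (\<gamma> [^] n) z)) \<longlonglongrightarrow> \<phi> h' b"
    using z by (intro act_tendsto[OF h'(1)] conv_tendsto[OF \<gamma>(2) tendsto_const])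
  from eventually_happens[OF tendstoD[OF this, of "\<delta> / 3"]] \<delta>(1) have ex: "\<exists>m. P m"
    unfolding P_def h'(2) by auto
  define m where "m = (LEAST m. P m)"
  have Pm: "P m" unfolding m_def by (rule LeastI_ex[OF ex])
  have "m \<noteq> 0" using Pm M' unfolding P_def by (intro notI) simp
  then obtain k where k: "m = Suc k" using not0_implies_Suc by blast
  hence nPk: "\<not> P k" using not_less_Least[of k P] unfolding m_def by simp
  define g where "g = h' \<otimes> \<gamma> [^] k"
  have g: "g \<in> carrier G" "\<phi> g x = \<phi> h' (\<phi> (\<gamma> [^] k) x)" for x
    using h' \<gamma>(1) by (simp_all add: g_def act_mult)
  have "\<phi> g (\<phi> \<gamma> z) = \<phi> h' (\<phi> (\<gamma> [^] m) z)"
    unfolding g(2) k act_pow_Suc[OF \<gamma>(1)] pow_mono_comm[OF \<gamma>(1)] by simp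
  moreover have "\<phi> g b = \<phi> h b" "\<phi> g a = \<phi> h a"
    unfolding g(2) using \<gamma>(1) fixed h' by (simp_all add: act_pow_fixed)
  ultimately show thesis
    using that[OF g(1)] \<delta>(2) Pm nPk unfolding P_def g(2) by (simp add: not_less)
qed

section \<open>Finiteness of expanding elements and the choice of scales\<close>

text \<open>Infinitely many such elements contain a convergence sequence. The limit of the points
  \<open>x n\<close> must be repelling, since otherwise \<open>x n\<close> and a test point far from
  it would have close images. Then \<open>b n\<close> and a test point are squeezed together,
  although their images are more than \<open>v - w\<close> apart.\<close>

lemma finite_expanding:
  assumes "\<theta> > 0" "w < v"
  shows "finite {g \<in> carrier G. \<exists>x b. \<theta> \<le> dist b x \<and> (\<forall>z. u0 \<le> dist z x \<longrightarrow> v \<le> dist (\<phi> g z) (\<phi> g x))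
           \<and> dist (\<phi> g b) (\<phi> g x) < w}" (is "finite ?S")
proof (rule ccontr)
  assume inf: "infinite ?S"
  obtain g \<beta> \<alpha> where g: "\<And>n. g n \<in> ?S" "conv g \<beta> \<alpha>"
    by (rule infinite_conv[OF inf]) auto
  define Q where "Q n x b \<longleftrightarrow> \<theta> \<le> dist b x \<and> (\<forall>z. u0 \<le> dist z x \<longrightarrow> v \<le> dist (\<phi> (g n) z) (\<phi> (g n) x))
    \<and> dist (\<phi> (g n) b) (\<phi> (g n) x) < w" for n x b
  have "\<exists>x b. Q n x b" for n using g(1)[of n] unfolding Q_def by simp
  then obtain x b where "\<And>n. Q n (x n) (b n)" by metis
  hence xb: "\<And>n. \<theta> \<le> dist (b n) (x n)"
    "\<And>n z. u0 \<le> dist z (x n) \<Longrightarrow> v \<le> dist (\<phi> (g n) z) (\<phi> (g n) (x n))"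
    "\<And>n. dist (\<phi> (g n) (b n)) (\<phi> (g n) (x n)) < w"
    unfolding Q_def by auto
  obtain r x' where r: "strict_mono (r::nat\<Rightarrow>nat)" "(\<lambda>n. x (r n)) \<longlonglongrightarrow> x'" by (rule subseq_lim)
  obtain s b' where s: "strict_mono (s::nat\<Rightarrow>nat)" "(\<lambda>n. b (r (s n))) \<longlonglongrightarrow> b'"
    using subseq_lim[of "\<lambda>n. b (r n)"] by metis
  define q where "q n = r (s n)" for n
  have q: "strict_mono q" using r(1) s(1) by (simp add: strict_mono_def q_def)
  have x': "(\<lambda>n. x (q n)) \<longlonglongrightarrow> x'"
    using LIMSEQ_subseq_LIMSEQ[OF r(2) s(1)] by (simp add: q_def comp_def)
  have b': "(\<lambda>n. b (q n)) \<longlonglongrightarrow> b'" using s(2) by (simp add: q_def)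
  have "\<theta> \<le> dist b' x'"
    using tendsto_dist[OF b' x'] xb(1) by (intro LIMSEQ_le_const) auto
  hence ne: "b' \<noteq> x'" using assms by auto
  have gq: "conv (\<lambda>n. g (q n)) \<beta> \<alpha>" by (rule conv_subseq[OF g(2) q])
  define e where "e = (v - w) / 2"
  have e: "e > 0" using assms by (simp add: e_def)
  have "0 < v"
    using xb(3)[of 0] assms zero_le_dist[of "\<phi> (g 0) (b 0)" "\<phi> (g 0) (x 0)"] by linarith
  have x'\<alpha>: "x' = \<alpha>"
  proof (rule ccontr)
    assume "x' \<noteq> \<alpha>"
    have "\<forall>\<^sub>F n in sequentially. dist (\<phi> (g (q n)) (x (q n))) \<beta> < v / 2"
      using tendstoD[OF conv_tendsto[OF gq x' \<open>x' \<noteq> \<alpha>\<close>], of "v / 2"] \<open>0 < v\<close> by simp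
    moreover have "\<forall>\<^sub>F n in sequentially. \<forall>p\<in>T. p \<noteq> \<alpha> \<longrightarrow> dist (\<phi> (g (q n)) p) \<beta> < v / 2"
      using conv_T[OF gq, of "v / 2"] \<open>0 < v\<close> by simp
    ultimately have "\<forall>\<^sub>F n in sequentially. False"
    proof eventually_elim
      case (elim n)
      obtain p where "p \<in> T" "p \<noteq> \<alpha>" "u0 \<le> dist p (x (q n))" using far by blast
      thus False using elim xb(2)[of p "q n"] dist_triangle2[of "\<phi> (g (q n)) p" "\<phi> (g (q n)) (x (q n))" \<beta>]
        by force
    qed
    thus False by simp
  qed
  have "\<forall>\<^sub>F n in sequentially. dist (\<phi> (g (q n)) (b (q n))) \<beta> < e"
    using tendstoD[OF conv_tendsto[OF gq b']] ne x'\<alpha> e by simp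
  moreover have "\<forall>\<^sub>F n in sequentially. \<forall>p\<in>T. p \<noteq> \<alpha> \<longrightarrow> dist (\<phi> (g (q n)) p) \<beta> < e"
    by (rule conv_T[OF gq e])
  ultimately have "\<forall>\<^sub>F n in sequentially. False"
  proof eventually_elim
    case (elim n)
    obtain p where "p \<in> T" "p \<noteq> \<alpha>" "u0 \<le> dist p (x (q n))" using far by blast
    hence "v \<le> dist (\<phi> (g (q n)) p) (\<phi> (g (q n)) (x (q n)))" "dist (\<phi> (g (q n)) p) \<beta> < e"
      using xb(2) elim by auto
    thus False using elim xb(3)[of "q n"] e_def
      dist_triangle2[of "\<phi> (g (q n)) p" "\<phi> (g (q n)) (b (q n))" \<beta>]
      dist_triangle[of "\<phi> (g (q n)) p" "\<phi> (g (q n)) (x (q n))" "\<phi> (g (q n)) (b (q n))"]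
      by argo
  qed
  thus False by simp
qed

text \<open>Below \<open>v / 2\<close> only finitely many elements can violate the bound, by
  \<open>finite_expanding\<close>; uniform continuity of the inverse of each gives it a positive
  bound, and \<open>w\<close> is the least of these and \<open>v / 2\<close>.\<close>

lemma next_scale:
  assumes "\<theta> > 0" "v > 0"
  shows "\<exists>w>0. w < v \<and> (\<forall>g\<in>carrier G. \<forall>x b. \<theta> \<le> dist b x \<longrightarrow>
    (\<forall>z. u0 \<le> dist z x \<longrightarrow> v \<le> dist (\<phi> g z) (\<phi> g x)) \<longrightarrow> w \<le> dist (\<phi> g b) (\<phi> g x))"
proof -
  define S where "S = {g \<in> carrier G. \<exists>x b. \<theta> \<le> dist b x \<and>
    (\<forall>z. u0 \<le> dist z x \<longrightarrow> v \<le> dist (\<phi> g z) (\<phi> g x)) \<and> dist (\<phi> g b) (\<phi> g x) < v / 2}"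
  have S: "finite S" unfolding S_def using assms by (intro finite_expanding) auto
  have "\<exists>d>0. \<forall>x y. dist (\<phi> g x) (\<phi> g y) < d \<longrightarrow> dist x y < \<theta>" if "g \<in> S" for g
  proof -
    have g: "g \<in> carrier G" using that S_def by auto
    obtain d where "d > 0" "\<And>x y. dist x y < d \<Longrightarrow> dist (\<phi> (inv g) x) (\<phi> (inv g) y) < \<theta>"
      using act_unif[of "inv g" \<theta>] g assms by auto
    thus ?thesis using g by (metis act_inv)
  qed
  then obtain d where d: "\<And>g. g \<in> S \<Longrightarrow> d g > (0::real)"
    "\<And>g x y. g \<in> S \<Longrightarrow> dist (\<phi> g x) (\<phi> g y) < d g \<Longrightarrow> dist x y < \<theta>" by metis
  define w where "w = Min (insert (v / 2) (d ` S))"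
  have "finite (insert (v / 2) (d ` S))" using S by simp
  hence "w \<in> insert (v / 2) (d ` S)" and w_le: "\<And>t. t \<in> insert (v / 2) (d ` S) \<Longrightarrow> w \<le> t"
    unfolding w_def by (intro Min_in Min_le; simp)+
  hence w: "w > 0" "w \<le> v / 2" "\<And>g. g \<in> S \<Longrightarrow> w \<le> d g"
    using d(1) assms(2) w_le[of "v / 2"] by auto
  have "w \<le> dist (\<phi> g b) (\<phi> g x)" if "g \<in> carrier G" "\<theta> \<le> dist b x"
    "\<forall>z. u0 \<le> dist z x \<longrightarrow> v \<le> dist (\<phi> g z) (\<phi> g x)" for g x b
  proof (rule ccontr)
    assume *: "\<not> ?thesis"
    hence "g \<in> S" using that w(2) unfolding S_def by force
    hence "dist b x < \<theta>" using d(2) w(3) * by force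
    thus False using that by simp
  qed
  thus ?thesis using w assms by (intro exI[of _ w]) auto
qed

text \<open>The threshold \<open>1 / Suc r\<close> tends to \<open>0\<close>, so a given pair of
  distinct points exceeds it for all large \<open>r\<close>. Hence only finitely many indices
  \<open>r\<close> can occur in annuli separating the pair.\<close>

lemma scales_exist:
  "\<exists>u. u 0 = u0 \<and> (\<forall>r. 0 < u r \<and> u (Suc r) < u r \<and> (\<forall>g\<in>carrier G. \<forall>x b. 1 / Suc r \<le> dist b x \<longrightarrow>
    (\<forall>z. u0 \<le> dist z x \<longrightarrow> u r \<le> dist (\<phi> g z) (\<phi> g x)) \<longrightarrow> u (Suc r) \<le> dist (\<phi> g b) (\<phi> g x)))"
proof -
  have "\<exists>u. \<forall>n. (0 < u n \<and> (n = 0 \<longrightarrow> u n = u0)) \<and> (u (Suc n) < u n \<and>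
    (\<forall>g\<in>carrier G. \<forall>x b. 1 / Suc n \<le> dist b x \<longrightarrow>
    (\<forall>z. u0 \<le> dist z x \<longrightarrow> u n \<le> dist (\<phi> g z) (\<phi> g x)) \<longrightarrow> u (Suc n) \<le> dist (\<phi> g b) (\<phi> g x)))"
  proof (rule dependent_nat_choice)
    fix v and n :: nat assume "0 < v \<and> (n = 0 \<longrightarrow> v = u0)"
    thus "\<exists>w. (0 < w \<and> (Suc n = 0 \<longrightarrow> w = u0)) \<and> (w < v \<and>
      (\<forall>g\<in>carrier G. \<forall>x b. 1 / Suc n \<le> dist b x \<longrightarrow>
      (\<forall>z. u0 \<le> dist z x \<longrightarrow> v \<le> dist (\<phi> g z) (\<phi> g x)) \<longrightarrow> w \<le> dist (\<phi> g b) (\<phi> g x)))"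
      using next_scale[of "1 / Suc n" v] by auto
  qed (use u0_pos in auto)
  then obtain u where u: "\<forall>n. (0 < u n \<and> (n = 0 \<longrightarrow> u n = u0)) \<and> (u (Suc n) < u n \<and>
    (\<forall>g\<in>carrier G. \<forall>x b. 1 / Suc n \<le> dist b x \<longrightarrow>
    (\<forall>z. u0 \<le> dist z x \<longrightarrow> u n \<le> dist (\<phi> g z) (\<phi> g x)) \<longrightarrow> u (Suc n) \<le> dist (\<phi> g b) (\<phi> g x)))"
    by (rule exE)
  show ?thesis by (rule exI[of _ u]) (simp add: u)
qed

end

section \<open>Chains of annuli\<close>

locale scaled_convergence = three_point_convergence G \<phi> T u0
  for G :: "('g, 'c) monoid_scheme" (structure) and \<phi> :: "'g \<Rightarrow> 'm::metric_space \<Rightarrow> 'm" and T u0 +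
  fixes u :: "nat \<Rightarrow> real"
  assumes u_0: "u 0 = u0" and u_pos: "\<And>r. 0 < u r" and u_Suc: "\<And>r. u (Suc r) < u r"
    and u_next: "\<And>r g x b. g \<in> carrier G \<Longrightarrow> 1 / Suc r \<le> dist b x \<Longrightarrow>
      (\<And>z. u0 \<le> dist z x \<Longrightarrow> u r \<le> dist (\<phi> g z) (\<phi> g x)) \<Longrightarrow> u (Suc r) \<le> dist (\<phi> g b) (\<phi> g x)"
begin

lemma u_antimono: "r \<le> s \<Longrightarrow> u s \<le> u r"
  using lift_Suc_antimono_le[of u] u_Suc by (simp add: less_imp_le)

text \<open>
  A pair \<open>(g, r)\<close> stands for the annulus between the discs around \<open>x\<close> on which \<open>dist (\<phi> g z) (\<phi> g x)\<close>
  is less than \<open>u r\<close> and less than \<open>u (Suc r)\<close>; \<open>link\<close> says that the outer disc of the second annulus is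
  contained in the inner disc of the first. The gap between the two radii is what makes the loss in
  \<open>chain_drop_wide\<close> finite: with a single radius, infinitely many elements could fail by an
  arbitrarily small margin.
\<close>

definition start :: "'g \<Rightarrow> nat \<Rightarrow> 'm \<Rightarrow> bool" where
  "start g r x \<longleftrightarrow> (\<forall>z. u0 \<le> dist z x \<longrightarrow> u r \<le> dist (\<phi> g z) (\<phi> g x))"

definition link :: "'m \<Rightarrow> 'g \<times> nat \<Rightarrow> 'g \<times> nat \<Rightarrow> bool" where
  "link x a b \<longleftrightarrow> (\<forall>z. u (Suc (snd a)) \<le> dist (\<phi> (fst a) z) (\<phi> (fst a) x) \<longrightarrow>
     u (snd b) \<le> dist (\<phi> (fst b) z) (\<phi> (fst b) x))"

definition separating :: "'m \<Rightarrow> 'm \<Rightarrow> ('g \<times> nat) set" where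
  "separating x y = {(g, r). g \<in> carrier G \<and> start g r x \<and> dist (\<phi> g y) (\<phi> g x) < u (Suc r)}"

text \<open>The pair is quantified inside the set, so that one finite cardinality serves as a bound
  for all pairs at distance at least \<open>\<theta>\<close>.\<close>

definition separating_wide :: "real \<Rightarrow> ('g \<times> nat) set" where
  "separating_wide \<theta> = {a. \<exists>x y. \<theta> \<le> dist y x \<and> a \<in> separating x y}"

text \<open>\<open>sorted_wrt\<close> asks for the relation between all pairs of entries, not only
  consecutive ones; \<open>a \<noteq> b\<close> makes the entries distinct and thus bounds the
  length.\<close>

definition chain :: "'m \<Rightarrow> 'm \<Rightarrow> ('g \<times> nat) list \<Rightarrow> bool" where
  "chain x y cs \<longleftrightarrow> set cs \<subseteq> separating x y \<and> sorted_wrt (\<lambda>a b. a \<noteq> b \<and> link x a b) cs"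

definition depth :: "'m \<Rightarrow> 'm \<Rightarrow> nat" where
  "depth x y = Max (length ` {cs. chain x y cs})"

text \<open>The choice of scales excludes all indices from \<open>m\<close> on. Each smaller index
  admits finitely many elements, thanks to the gap between \<open>u (Suc r)\<close> and
  \<open>u r\<close>.\<close>

lemma finite_separating_wide:
  assumes "\<theta> > 0" shows "finite (separating_wide \<theta>)"
proof -
  obtain m where m: "inverse (real (Suc m)) < \<theta>" using reals_Archimedean[OF assms] by blast
  define F where "F r = {g \<in> carrier G. \<exists>x b. \<theta> \<le> dist b x \<and>
    (\<forall>z. u0 \<le> dist z x \<longrightarrow> u r \<le> dist (\<phi> g z) (\<phi> g x)) \<and> dist (\<phi> g b) (\<phi> g x) < u (Suc r)}" for r
  have F: "finite (F r)" for r unfolding F_def by (intro finite_expanding assms u_Suc)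
  have "separating_wide \<theta> \<subseteq> (\<Union>r<m. (\<lambda>g. (g, r)) ` F r)"
  proof
    fix a assume "a \<in> separating_wide \<theta>"
    then obtain g r x b where a: "a = (g, r)" "g \<in> carrier G" "\<theta> \<le> dist b x"
      "start g r x" "dist (\<phi> g b) (\<phi> g x) < u (Suc r)"
      unfolding separating_wide_def separating_def by auto
    have "r < m"
    proof (rule ccontr)
      assume "\<not> r < m"
      hence "1 / real (Suc r) \<le> inverse (real (Suc m))" by (simp add: divide_simps)
      hence "1 / real (Suc r) \<le> dist b x" using m a(3) by linarith
      from u_next[OF a(2) this] a(4,5) show False unfolding start_def by force
    qed
    moreover have "g \<in> F r" using a unfolding F_def start_def by auto
    ultimately show "a \<in> (\<Union>r<m. (\<lambda>g. (g, r)) ` F r)" using a(1) by auto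
  qed
  thus ?thesis using F by (meson finite_UN_I finite_imageI finite_lessThan finite_subset)
qed

lemma finite_separating: assumes "x \<noteq> y" shows "finite (separating x y)"
proof -
  have "separating x y \<subseteq> separating_wide (dist y x)" unfolding separating_wide_def by auto
  thus ?thesis using finite_separating_wide[of "dist y x"] assms finite_subset by auto
qed

lemma chain_distinct: "chain x y cs \<Longrightarrow> distinct cs"
  unfolding chain_def distinct_conv_nth sorted_wrt_iff_nth_less by (metis nat_neq_iff)

lemma chain_lengths:
  assumes "x \<noteq> y"
  shows "finite (length ` {cs. chain x y cs})" "length ` {cs. chain x y cs} \<noteq> {}"
proof -
  have "length cs \<le> card (separating x y)" if "chain x y cs" for cs
    using that distinct_card[OF chain_distinct[OF that]] card_mono[OF finite_separating[OF assms], of "set cs"]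
    unfolding chain_def by auto
  hence "length ` {cs. chain x y cs} \<subseteq> {..card (separating x y)}" by auto
  thus "finite (length ` {cs. chain x y cs})" by (rule finite_subset) simp
  have "chain x y []" by (simp add: chain_def)
  thus "length ` {cs. chain x y cs} \<noteq> {}" by auto
qed

lemma chain_length_le: "x \<noteq> y \<Longrightarrow> chain x y cs \<Longrightarrow> length cs \<le> depth x y"
  unfolding depth_def by (intro Max_ge chain_lengths) auto

lemma depth_attained: assumes "x \<noteq> y" obtains cs where "chain x y cs" "length cs = depth x y"
  using Max_in[OF chain_lengths[OF assms]] unfolding depth_def by auto

text \<open>By counting, one of the first \<open>N + 1\<close> entries is not in
  \<open>separating_wide \<theta>\<close>, so \<open>z\<close> is outside its inner disc. Nesting
  puts \<open>z\<close> outside the outer disc of every later entry.\<close>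

lemma chain_drop_wide:
  assumes cs: "chain x y cs" and \<theta>: "\<theta> > 0"
    and a: "a \<in> set (drop (Suc (card (separating_wide \<theta>))) cs)" and z: "\<theta> \<le> dist z x"
  shows "u (snd a) \<le> dist (\<phi> (fst a) z) (\<phi> (fst a) x)"
proof -
  define N where "N = card (separating_wide \<theta>)"
  obtain j where j: "N < j" "j < length cs" "a = cs ! j"
  proof -
    obtain i where "i < length (drop (Suc N) cs)" "drop (Suc N) cs ! i = a"
      using a unfolding N_def[symmetric] in_set_conv_nth by blast
    thus ?thesis using that[of "Suc N + i"] by simp
  qed
  have "\<not> set (take (Suc N) cs) \<subseteq> separating_wide \<theta>"
  proof
    assume "set (take (Suc N) cs) \<subseteq> separating_wide \<theta>"
    hence "card (set (take (Suc N) cs)) \<le> N"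
      unfolding N_def by (intro card_mono finite_separating_wide \<theta>)
    moreover have "card (set (take (Suc N) cs)) = Suc N"
      using distinct_card[OF distinct_take[OF chain_distinct[OF cs]], of "Suc N"] j by simp
    ultimately show False by simp
  qed
  then obtain b where b: "b \<in> set (take (Suc N) cs)" "b \<notin> separating_wide \<theta>" by blast
  then obtain i where i: "i \<le> N" "b = cs ! i" using j unfolding in_set_conv_nth by (auto simp: less_Suc_eq_le)
  have "b \<in> separating x y" using b(1) cs set_take_subset[of "Suc N" cs] unfolding chain_def by blast
  hence "fst b \<in> carrier G" "start (fst b) (snd b) x" unfolding separating_def by auto
  hence "u (Suc (snd b)) \<le> dist (\<phi> (fst b) z) (\<phi> (fst b) x)"
    using b(2) z unfolding separating_wide_def separating_def by (cases b) (auto simp: not_less)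
  moreover have "link x b a"
    using cs i j unfolding chain_def sorted_wrt_iff_nth_less by auto
  ultimately show ?thesis unfolding link_def by blast
qed

text \<open>A longest chain for the image pair, shortened by \<open>N + 1\<close> entries, pulls
  back to annuli inside the \<open>u s\<close>-ball about \<open>x n\<close>. Around them fit
  \<open>s\<close> annuli of the identity, which more than make up for the loss.\<close>

lemma depth_decreases:
  assumes h: "conv h b \<xi>" and x: "x \<longlonglongrightarrow> \<xi>" and y: "y \<longlonglongrightarrow> \<xi>" and xy: "\<And>n. x n \<noteq> y n"
    and hx: "(\<lambda>n. \<phi> (h n) (x n)) \<longlonglongrightarrow> c" and "c \<noteq> b"
  shows "\<exists>n. depth (\<phi> (h n) (x n)) (\<phi> (h n) (y n)) < depth (x n) (y n)"
proof -
  define \<theta> where "\<theta> = dist b c / 2"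
  have \<theta>: "\<theta> > 0" using \<open>c \<noteq> b\<close> by (simp add: \<theta>_def)
  define N where "N = card (separating_wide \<theta>)"
  \<comment> \<open>One more than the \<open>N + 1\<close> entries that are dropped, so that the new
    chain is strictly longer.\<close>
  define s where "s = N + 2"
  have us: "u s > 0" by (rule u_pos)
  have "\<forall>\<^sub>F n in sequentially. dist (y n) (x n) < u s"
    using tendstoD[OF tendsto_dist[OF y x] us] by simp
  moreover have "\<forall>\<^sub>F n in sequentially. dist (x n) \<xi> < u s / 2"
    using tendstoD[OF x, of "u s / 2"] us by simp
  moreover have "\<forall>\<^sub>F n in sequentially. dist (\<phi> (h n) (x n)) c < \<theta> / 2"
    using tendstoD[OF hx, of "\<theta> / 2"] \<theta> by simp
  moreover have "\<forall>\<^sub>F n in sequentially. \<forall>z. u s / 2 \<le> dist z \<xi> \<longrightarrow> dist (\<phi> (h n) z) b < \<theta> / 2"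
    using convD[OF h, of "u s / 2" "\<theta> / 2"] us \<theta> by simp
  moreover have "\<forall>\<^sub>F n in sequentially. \<forall>p\<in>T. p \<noteq> b \<longrightarrow> dist (\<phi> (inv (h n)) p) \<xi> < u s / 2"
    using conv_T[OF conv_inv[OF h], of "u s / 2"] us by simp
  ultimately have "\<forall>\<^sub>F n in sequentially. depth (\<phi> (h n) (x n)) (\<phi> (h n) (y n)) < depth (x n) (y n)"
  proof eventually_elim
    case (elim n)
    define X where "X = x n" define Y where "Y = y n" define f where "f = h n"
    have f: "f \<in> carrier G" unfolding f_def by (rule conv_closed[OF h])
    have ne: "X \<noteq> Y" "\<phi> f X \<noteq> \<phi> f Y" using xy f by (auto simp: X_def Y_def)
    \<comment> \<open>Points outside the \<open>u s\<close>-ball about \<open>X\<close> are sent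
      near \<open>b\<close>, while \<open>X\<close> is sent near \<open>c\<close>; two errors of
      \<open>\<theta> / 2\<close> are taken from \<open>dist b c = 2 * \<theta>\<close>.\<close>
    have expand: "\<theta> \<le> dist (\<phi> f z) (\<phi> f X)" if "u s \<le> dist z X" for z
    proof -
      have "u s / 2 \<le> dist z \<xi>"
        using that elim(2) dist_triangle2[of z X \<xi>] unfolding X_def by (simp add: dist_commute)
      hence "dist (\<phi> f z) b < \<theta> / 2" using elim(4) unfolding f_def by blast
      moreover have "2 * \<theta> = dist b c" by (simp add: \<theta>_def)
      moreover have "dist b c \<le> dist (\<phi> f z) b + dist (\<phi> f z) (\<phi> f X) + dist (\<phi> f X) c"
        using dist_triangle[of b c "\<phi> f z"] dist_triangle[of "\<phi> f z" c "\<phi> f X"] by (simp add: dist_commute)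
      ultimately show ?thesis using elim(3) unfolding f_def X_def by linarith
    qed
    \<comment> \<open>A test point whose preimage lies within \<open>u s\<close> of
      \<open>X\<close>. Were a pulled back annulus equal to \<open>(\<one>, r)\<close> with
      \<open>r < s\<close>, this preimage would have to be at distance at least \<open>u r\<close>
      from \<open>X\<close>.\<close>
    obtain w where "w \<in> T" "w \<noteq> b" and w: "u0 \<le> dist w (\<phi> f X)" using far by blast
    hence "dist (\<phi> (inv f) w) \<xi> < u s / 2" using elim(5) unfolding f_def by blast
    hence w': "dist (\<phi> (inv f) w) X < u s"
      using elim(2) dist_triangle2[of "\<phi> (inv f) w" X \<xi>] unfolding X_def by simp
    obtain cs where cs: "chain (\<phi> f X) (\<phi> f Y) cs" "length cs = depth (\<phi> f X) (\<phi> f Y)"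
      by (rule depth_attained[OF ne(2)])
    define ds where "ds = drop (Suc N) cs"
    define t where "t = (\<lambda>a :: 'g \<times> nat. (fst a \<otimes> f, snd a))"
    \<comment> \<open>The annuli around \<open>X\<close> at the first \<open>s\<close> scales, followed by the pullback of all but \<open>N + 1\<close>
      annuli of the chain for the translated pair.\<close>
    define es where "es = map (\<lambda>r. (\<one>, r)) [0..<s] @ map t ds"
    have ds: "set ds \<subseteq> separating (\<phi> f X) (\<phi> f Y)"
      using cs(1) set_drop_subset[of "Suc N" cs] unfolding chain_def ds_def by blast
    have act: "\<phi> (fst (t a)) z = \<phi> (fst a) (\<phi> f z)" if "a \<in> set ds" for a z
    proof -
      have "fst a \<in> carrier G" using that ds unfolding separating_def by auto
      thus ?thesis using f by (simp add: t_def act_mult)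
    qed
    have good: "u (snd a) \<le> dist (\<phi> (fst (t a)) z) (\<phi> (fst (t a)) X)"
      if "a \<in> set ds" "u s \<le> dist z X" for a z
      using chain_drop_wide[OF cs(1) \<theta>] expand[OF that(2)] that(1) unfolding act[OF that(1)] ds_def N_def by blast
    have "t a \<in> separating X Y" if a: "a \<in> set ds" for a
    proof -
      have "fst a \<in> carrier G" "dist (\<phi> (fst a) (\<phi> f Y)) (\<phi> (fst a) (\<phi> f X)) < u (Suc (snd a))"
        using a ds unfolding separating_def by auto
      moreover have "start (fst (t a)) (snd a) X"
        unfolding start_def using good[OF a] u_antimono[of 0 s] u_0 by auto
      moreover have "t a = (fst (t a), snd a)" by (simp add: t_def)
      ultimately show ?thesis unfolding separating_def using f act[OF a] by (auto simp: t_def)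
    qed
    moreover have "(\<one>, r) \<in> separating X Y" if "r < s" for r
      unfolding separating_def start_def
      using that elim(1) u_antimono[of 0 r] u_antimono[of "Suc r" s] u_0 unfolding X_def Y_def by auto
    ultimately have "set es \<subseteq> separating X Y" unfolding es_def by auto
    moreover have "sorted_wrt (\<lambda>a b. a \<noteq> b \<and> link X a b) (map (\<lambda>r. (\<one>, r)) [0..<s])"
      unfolding sorted_wrt_map
      by (rule sorted_wrt_mono_rel[OF _ sorted_wrt_upt])
        (auto simp: link_def Suc_le_eq[symmetric] dest: u_antimono)
    moreover have "sorted_wrt (\<lambda>a b. a \<noteq> b \<and> link X a b) (map t ds)"
      unfolding sorted_wrt_map
    proof (rule sorted_wrt_mono_rel)
      show "sorted_wrt (\<lambda>a b. a \<noteq> b \<and> link (\<phi> f X) a b) ds"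
        using cs(1) unfolding chain_def ds_def by (auto intro: sorted_wrt_drop)
      fix a a' assume a: "a \<in> set ds" "a' \<in> set ds" and l: "a \<noteq> a' \<and> link (\<phi> f X) a a'"
      have "fst a \<in> carrier G" "fst a' \<in> carrier G" using a ds unfolding separating_def by auto
      hence "t a \<noteq> t a'" using l f by (auto simp: t_def prod_eq_iff)
      moreover have "snd (t a) = snd a" "snd (t a') = snd a'" by (auto simp: t_def)
      ultimately show "t a \<noteq> t a' \<and> link X (t a) (t a')" using l unfolding link_def act[OF a(1)] act[OF a(2)] by auto
    qed
    \<comment> \<open>The identity annuli used have inner radius at least \<open>u s\<close>, and by
      \<open>good\<close> the outer discs of the pulled back annuli lie within that distance of
      \<open>X\<close>.\<close>
    moreover have "(\<one>, r) \<noteq> t a \<and> link X (\<one>, r) (t a)" if "r < s" and a: "a \<in> set ds" for r a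
    proof
      show "link X (\<one>, r) (t a)"
        unfolding link_def using good[OF a] u_antimono[of "Suc r" s] \<open>r < s\<close> by (auto simp: t_def)
      show "(\<one>, r) \<noteq> t a"
      proof
        assume eq: "(\<one>, r) = t a"
        have "start (fst a) (snd a) (\<phi> f X)" using a ds unfolding separating_def by auto
        hence "u (snd a) \<le> dist (\<phi> (fst a) (\<phi> f (\<phi> (inv f) w))) (\<phi> (fst a) (\<phi> f X))"
          using w f unfolding start_def by simp
        also have "\<dots> = dist (\<phi> (inv f) w) X" using eq unfolding act[OF a, symmetric] by (metis act_one fst_conv)
        finally have "u (snd a) < u s" using w' by simp
        moreover have "snd a = r" using eq by (simp add: t_def)
        ultimately show False using u_antimono[of r s] \<open>r < s\<close> by simp
      qed
    qed
    ultimately have "chain X Y es" unfolding chain_def es_def by (auto simp: sorted_wrt_append)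
    hence "length es \<le> depth X Y" by (rule chain_length_le[OF ne(1)])
    moreover have "length cs < length es" by (auto simp: es_def ds_def s_def)
    ultimately show ?case using cs(2) by (simp add: X_def Y_def f_def)
  qed
  thus ?thesis using eventually_happens[of _ sequentially] by auto
qed

section \<open>Limits of pairs of minimal depth\<close>

text \<open>For each \<open>k\<close> an index \<open>m k\<close> is taken so large that
  \<open>h k\<close> moves \<open>x (m k)\<close> almost as it moves \<open>\<xi>\<close>. Along
  these indices \<open>depth_decreases\<close> contradicts minimality.\<close>

lemma depth_minimal_limit_not_conical:
  assumes x: "x \<longlonglongrightarrow> \<xi>" and y: "y \<longlonglongrightarrow> \<xi>" and xy: "\<And>n. x n \<noteq> y n"
    and min: "\<And>n h. h \<in> carrier G \<Longrightarrow> depth (x n) (y n) \<le> depth (\<phi> h (x n)) (\<phi> h (y n))"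
  shows "\<not> conical G \<phi> \<xi>"
proof
  assume "conical G \<phi> \<xi>"
  then obtain h b c where h: "conv h b \<xi>" "(\<lambda>n. \<phi> (h n) \<xi>) \<longlonglongrightarrow> c" "c \<noteq> b"
    unfolding conical_iff by blast
  have hc: "h k \<in> carrier G" for k by (rule conv_closed[OF h(1)])
  have "\<exists>n. dist (\<phi> (h k) (x n)) (\<phi> (h k) \<xi>) < 1 / Suc k \<and> dist (x n) \<xi> < 1 / Suc k \<and> dist (y n) \<xi> < 1 / Suc k" for k
  proof -
    have "\<forall>\<^sub>F n in sequentially. dist (\<phi> (h k) (x n)) (\<phi> (h k) \<xi>) < 1 / Suc k \<and>
      dist (x n) \<xi> < 1 / Suc k \<and> dist (y n) \<xi> < 1 / Suc k"
      by (intro eventually_conj tendstoD[OF act_tendsto[OF hc x]] tendstoD[OF x] tendstoD[OF y]) auto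
    thus ?thesis using eventually_happens[of _ sequentially] by auto
  qed
  then obtain m where m: "\<And>k. dist (\<phi> (h k) (x (m k))) (\<phi> (h k) \<xi>) < 1 / Suc k"
    "\<And>k. dist (x (m k)) \<xi> < 1 / Suc k" "\<And>k. dist (y (m k)) \<xi> < 1 / Suc k" by metis
  have "(\<lambda>k. x (m k)) \<longlonglongrightarrow> \<xi>" "(\<lambda>k. y (m k)) \<longlonglongrightarrow> \<xi>" 
    using tendsto_if_dist_lt_inverse[OF m(2) tendsto_const] tendsto_if_dist_lt_inverse[OF m(3) tendsto_const] .
  from depth_decreases[OF h(1) this xy tendsto_if_dist_lt_inverse[OF m(1) h(2)] h(3)]
  obtain k where "depth (\<phi> (h k) (x (m k))) (\<phi> (h k) (y (m k))) < depth (x (m k)) (y (m k))" by blast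
  thus False using min[OF hc, of "m k" k] by simp
qed

text \<open>Cocompactness gives stabilizer elements \<open>p n\<close> moving \<open>x n\<close>
  into a compact set off \<open>\<xi>\<close>. As \<open>x n\<close> tends to the fixed point
  \<open>\<xi>\<close>, they have no constant subsequence, and both points of a convergence
  subsequence are \<open>\<xi>\<close>. So \<open>depth_decreases\<close> applies with
  \<open>c \<noteq> \<xi>\<close>.\<close>

lemma depth_minimal_limit_not_bounded_parabolic:
  assumes x: "x \<longlonglongrightarrow> \<xi>" and y: "y \<longlonglongrightarrow> \<xi>" and xy: "\<And>n. x n \<noteq> y n"
    and min: "\<And>n h. h \<in> carrier G \<Longrightarrow> depth (x n) (y n) \<le> depth (\<phi> h (x n)) (\<phi> h (y n))"
    and \<Lambda>: "\<And>n. x n \<in> \<Lambda>" "\<And>n. y n \<in> \<Lambda>"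
    and S: "S \<longlonglongrightarrow> (0::real)" "\<And>h n. h \<in> carrier G \<Longrightarrow> dist (\<phi> h (x n)) (\<phi> h (y n)) \<le> S n"
  shows "\<not> bounded_parabolic G \<phi> \<xi>"
proof
  assume bp: "bounded_parabolic G \<phi> \<xi>"
  let ?St = "stabilizer G \<phi> \<xi>"
  have lim: "limit_set \<phi> ?St = {\<xi>}" using bp unfolding bounded_parabolic_def parabolic_def by auto
  obtain K where K: "compact K" "K \<subseteq> \<Lambda> - {\<xi>}" "(\<Union>h\<in>?St. \<phi> h ` K) = \<Lambda> - {\<xi>}"
    using bp unfolding bounded_parabolic_def acts_cocompactly_def by auto
  obtain d where d: "d > 0" "\<And>z. z \<in> K \<Longrightarrow> d \<le> dist \<xi> z"
  proof -
    have "open (- K)" "\<xi> \<in> - K" using compact_imp_closed[OF K(1)] K(2) by auto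
    then obtain d where "d > 0" "ball \<xi> d \<subseteq> - K" by (rule openE)
    hence "d \<le> dist \<xi> z" if "z \<in> K" for z using that by (meson ComplD in_mono mem_ball not_less)
    thus ?thesis using that \<open>d > 0\<close> by blast
  qed
  have move: "\<exists>p\<in>?St. \<phi> p z \<in> K" if z: "z \<in> \<Lambda>" "z \<noteq> \<xi>" for z
  proof -
    obtain p k where p: "p \<in> ?St" "k \<in> K" "\<phi> p k = z"
    proof -
      have "z \<in> (\<Union>h\<in>?St. \<phi> h ` K)" unfolding K(3) using z by simp
      thus ?thesis using that by auto
    qed
    have pc: "p \<in> carrier G" "\<phi> p \<xi> = \<xi>" using p(1) unfolding stabilizer_def by auto
    have "\<phi> (inv p) \<xi> = \<xi>" using act_inv[OF pc(1), of \<xi>] pc(2) by simp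
    hence "inv p \<in> ?St" using pc(1) by (simp add: stabilizer_def)
    moreover have "\<phi> (inv p) z = k" using p(3) pc by auto
    ultimately show ?thesis using p(2) by blast
  qed
  obtain n0 where n0: "\<And>n. n \<ge> n0 \<Longrightarrow> S n < d"
    using order_tendstoD(2)[OF S(1) d(1)] unfolding eventually_sequentially by blast
  have "\<exists>p\<in>?St. \<phi> p (x (n + n0)) \<in> K" for n
  proof (rule move)
    \<comment> \<open>Otherwise a stabilizer element moves \<open>y (n + n0)\<close> into
      \<open>K\<close>, at distance at least \<open>d\<close> from the fixed point
      \<open>\<xi>\<close>, although all translates of the pair have diameter at most
      \<open>S (n + n0) < d\<close>.\<close>
    show "x (n + n0) \<noteq> \<xi>"
    proof
      assume eq: "x (n + n0) = \<xi>"
      then obtain p where p: "p \<in> ?St" "\<phi> p (y (n + n0)) \<in> K" using move \<Lambda>(2) xy by metis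
      hence "d \<le> dist (\<phi> p (x (n + n0))) (\<phi> p (y (n + n0)))"
        using d(2) eq unfolding stabilizer_def by auto
      also have "\<dots> < d" using S(2)[of p "n + n0"] n0[of "n + n0"] p(1) stabilizer_subset by fastforce
      finally show False by simp
    qed
  qed (rule \<Lambda>)
  then obtain p where p: "\<And>n. p n \<in> ?St" "\<And>n. \<phi> (p n) (x (n + n0)) \<in> K" by metis
  have p\<xi>: "p n \<in> carrier G" "\<phi> (p n) \<xi> = \<xi>" for n using p(1)[of n] unfolding stabilizer_def by auto
  have x': "(\<lambda>n. x (n + n0)) \<longlonglongrightarrow> \<xi>" and y': "(\<lambda>n. y (n + n0)) \<longlonglongrightarrow> \<xi>"
    using x y by (auto intro: LIMSEQ_ignore_initial_segment)
  have away: "\<not> (\<lambda>n. \<phi> (p (r n)) (x (r n + n0))) \<longlonglongrightarrow> \<xi>" for r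
  proof
    assume "(\<lambda>n. \<phi> (p (r n)) (x (r n + n0))) \<longlonglongrightarrow> \<xi>"
    from eventually_happens[OF tendstoD[OF this d(1)]]
    obtain n where "dist (\<phi> (p (r n)) (x (r n + n0))) \<xi> < d" by auto
    thus False using d(2)[OF p(2)[of "r n"]] by (simp add: dist_commute)
  qed
  from p\<xi>(1) show False
  proof (cases rule: const_or_conv[of p])
    case (const r c)
    have "(\<lambda>n. \<phi> c (x (r n + n0))) \<longlonglongrightarrow> \<phi> c \<xi>"
      using LIMSEQ_subseq_LIMSEQ[OF x' const(1)] by (intro act_tendsto const(3)) (simp add: comp_def)
    moreover have "\<phi> c \<xi> = \<xi>" using const(2)[of 0] p\<xi>(2) by metis
    ultimately show False using away[of r] const(2) by simp
  next
    case (conv r b a)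
    have xr: "(\<lambda>n. x (r n + n0)) \<longlonglongrightarrow> \<xi>" "(\<lambda>n. y (r n + n0)) \<longlonglongrightarrow> \<xi>"
      using LIMSEQ_subseq_LIMSEQ[OF x' conv(1)] LIMSEQ_subseq_LIMSEQ[OF y' conv(1)] by (simp_all add: comp_def)
    have "b \<in> limit_set \<phi> ?St" unfolding limit_set_stabilizer_iff using conv(3) p\<xi>(2) by blast
    hence b: "b = \<xi>" using lim by simp
    have a: "a = \<xi>"
    proof (rule ccontr)
      assume "a \<noteq> \<xi>"
      hence "(\<lambda>n. \<phi> (p (r n)) (x (r n + n0))) \<longlonglongrightarrow> \<xi>" using conv_tendsto[OF conv(3) xr(1)] b by simp
      thus False using away by blast
    qed
    obtain s c where s: "strict_mono (s :: nat \<Rightarrow> nat)" "(\<lambda>n. \<phi> (p (r (s n))) (x (r (s n) + n0))) \<longlonglongrightarrow> c"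
      using subseq_lim[of "\<lambda>n. \<phi> (p (r n)) (x (r n + n0))"] by metis
    have "c \<noteq> \<xi>" using s(2) away[of "\<lambda>n. r (s n)"] by blast
    moreover have "(\<lambda>n. x (r (s n) + n0)) \<longlonglongrightarrow> \<xi>" "(\<lambda>n. y (r (s n) + n0)) \<longlonglongrightarrow> \<xi>"
      using LIMSEQ_subseq_LIMSEQ[OF xr(1) s(1)] LIMSEQ_subseq_LIMSEQ[OF xr(2) s(1)] by (simp_all add: comp_def)
    ultimately obtain n where
      "depth (\<phi> (p (r (s n))) (x (r (s n) + n0))) (\<phi> (p (r (s n))) (y (r (s n) + n0))) < depth (x (r (s n) + n0)) (y (r (s n) + n0))"
      using depth_decreases[OF conv_subseq[OF conv(3) s(1), unfolded a b] _ _ xy s(2)] by blast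
    thus False using min[OF p\<xi>(1)[of "r (s n)"], of "r (s n) + n0"] by simp
  qed
qed

text \<open>The supremum controls every translate, hence also the translates of minimal depth, so
  both endpoints of these converge to one point \<open>\<xi>\<close> of the limit set.\<close>

lemma escaping_imp_geometrically_infinite:
  assumes hyp: "\<And>n. hyperbolic G \<phi> (g n)" and esc: "escaping G \<phi> g"
  shows "\<not> geometrically_finite G \<phi>"
proof
  assume gf: "geometrically_finite G \<phi>"
  define b where "b n = attracting_fixed_point G \<phi> (g n)" for n
  define a where "a n = repelling_fixed_point G \<phi> (g n)" for n
  define S where "S n = (SUP h\<in>carrier G. dist (\<phi> h (b n)) (\<phi> h (a n)))" for n
  have S: "S \<longlonglongrightarrow> 0" using esc unfolding escaping_def S_def[abs_def] a_def b_def .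
  have leS: "dist (\<phi> h (b n)) (\<phi> h (a n)) \<le> S n" if "h \<in> carrier G" for h n
    unfolding S_def by (rule dist_le_SUP[OF that])
  have ab: "b n \<noteq> a n" "b n \<in> \<Lambda>" "a n \<in> \<Lambda>" for n
    using hyperbolic_fixed_points(1)[OF hyp] hyperbolic_fixed_points_limit_set[OF hyp] by (simp_all add: a_def b_def)
  have "\<exists>k. k \<in> carrier G \<and> (\<forall>h. h \<in> carrier G \<longrightarrow> depth (\<phi> k (b n)) (\<phi> k (a n)) \<le> depth (\<phi> h (b n)) (\<phi> h (a n)))" for n
    using ex_has_least_nat[of "\<lambda>k. k \<in> carrier G" \<one> "\<lambda>k. depth (\<phi> k (b n)) (\<phi> k (a n))"] by simp
  then obtain k where k: "\<And>n. k n \<in> carrier G"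
    "\<And>n h. h \<in> carrier G \<Longrightarrow> depth (\<phi> (k n) (b n)) (\<phi> (k n) (a n)) \<le> depth (\<phi> h (b n)) (\<phi> h (a n))" by metis
  obtain r \<xi> where r: "strict_mono (r :: nat \<Rightarrow> nat)" "(\<lambda>n. \<phi> (k (r n)) (b (r n))) \<longlonglongrightarrow> \<xi>"
    by (rule subseq_lim)
  define x where "x n = \<phi> (k (r n)) (b (r n))" for n
  define y where "y n = \<phi> (k (r n)) (a (r n))" for n
  have xy: "x n \<noteq> y n" "x n \<in> \<Lambda>" "y n \<in> \<Lambda>" for n
    using ab k(1) by (auto simp: x_def y_def limit_set_act)
  have Sr: "(\<lambda>n. S (r n)) \<longlonglongrightarrow> 0" using LIMSEQ_subseq_LIMSEQ[OF S r(1)] by (simp add: comp_def)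
  have le: "dist (\<phi> h (x n)) (\<phi> h (y n)) \<le> S (r n)" if "h \<in> carrier G" for h n
    using leS[of "h \<otimes> k (r n)" "r n"] that k(1) by (simp add: x_def y_def act_mult)
  have x: "x \<longlonglongrightarrow> \<xi>" using r(2) by (simp add: x_def[abs_def])
  have "(\<lambda>n. dist (x n) (y n)) \<longlonglongrightarrow> 0"
    by (rule Lim_null_comparison[OF _ Sr]) (use le[OF one_closed] in auto)
  hence y: "y \<longlonglongrightarrow> \<xi>" using x by (rule tendsto_if_dist_null)
  have min: "depth (x n) (y n) \<le> depth (\<phi> h (x n)) (\<phi> h (y n))" if "h \<in> carrier G" for h n
    using k(2)[of "h \<otimes> k (r n)" "r n"] that k(1) by (simp add: x_def y_def act_mult)
  have "\<xi> \<in> \<Lambda>" by (rule limit_set_limit[OF xy(2) x])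
  thus False
    using gf depth_minimal_limit_not_conical[OF x y xy(1) min]
      depth_minimal_limit_not_bounded_parabolic[OF x y xy(1) min xy(2,3) Sr le]
    unfolding geometrically_finite_def by blast
qed

end

section \<open>Non-conical limit points\<close>

text \<open>\<open>12 * v \<le> \<delta>\<close> provides
  \<open>\<delta> / 5 - \<delta> / 30 \<ge> 2 * v\<close> in
  \<open>terminal_not_accumulating\<close>; \<open>2 * v \<le> u0\<close> keeps a test point at
  distance \<open>v\<close> from a point whose position is known up to \<open>v\<close>.\<close>

locale nonconical_point = three_point_convergence G \<phi> T u0
  for G :: "('g, 'c) monoid_scheme" (structure) and \<phi> :: "'g \<Rightarrow> 'm::metric_space \<Rightarrow> 'm" and T u0 +
  fixes \<xi> :: 'm and \<delta> v :: real
  assumes \<xi>: "\<xi> \<in> \<Lambda>" and nonconical: "\<not> conical G \<phi> \<xi>"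
    and not_escaping: "\<And>\<gamma>. hyperbolic G \<phi> \<gamma> \<Longrightarrow> \<exists>h\<in>carrier G.
      \<delta> \<le> dist (\<phi> h (attracting_fixed_point G \<phi> \<gamma>)) (\<phi> h (repelling_fixed_point G \<phi> \<gamma>))"
    and v: "0 < v" "12 * v \<le> \<delta>" "2 * v \<le> u0"
begin

section \<open>Separators and terminal points\<close>

text \<open>These sets compose: a separator of \<open>\<phi> g \<eta>\<close> after a separator
  \<open>g\<close> of \<open>\<eta>\<close> is again a separator of \<open>\<eta>\<close>. Applying
  \<open>g\<close> thus never increases their finite number.\<close>

definition separators :: "'m \<Rightarrow> 'g set" where
  "separators \<eta> = {g \<in> carrier G. \<forall>z. v \<le> dist z \<eta> \<longrightarrow> v \<le> dist (\<phi> g z) (\<phi> g \<eta>)}"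

text \<open>The condition on the inverse says that right multiplication by \<open>g\<close> maps the
  separators of \<open>\<phi> g \<eta>\<close> onto those of \<open>\<eta>\<close>, so that none is
  lost.\<close>

definition terminal :: "'m \<Rightarrow> bool" where
  "terminal \<eta> \<longleftrightarrow> (\<exists>k\<in>carrier G. \<eta> = \<phi> k \<xi>) \<and> (\<forall>g\<in>separators \<eta>. inv g \<in> separators (\<phi> g \<eta>))"

text \<open>A convergence sequence of separators would bring a non-conical point and a test point
  far from it to the same attracting point.\<close>

lemma finite_separators:
  assumes "k \<in> carrier G" shows "finite (separators (\<phi> k \<xi>))"
proof (rule ccontr)
  assume inf: "infinite (separators (\<phi> k \<xi>))"
  obtain g b a where g: "\<And>n. g n \<in> separators (\<phi> k \<xi>)" "conv g b a"
    by (rule infinite_conv[OF inf]) (auto simp: separators_def)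
  have "(\<lambda>n. \<phi> (g n) (\<phi> k \<xi>)) \<longlonglongrightarrow> b"
    using nonconical_tendsto[OF _ g(2)] nonconical conical_act[OF assms] by blast
  hence "\<forall>\<^sub>F n in sequentially. dist (\<phi> (g n) (\<phi> k \<xi>)) b < v / 2"
    using v by (intro tendstoD) auto
  moreover have "\<forall>\<^sub>F n in sequentially. \<forall>p\<in>T. p \<noteq> a \<longrightarrow> dist (\<phi> (g n) p) b < v / 2"
    using v by (intro conv_T[OF g(2)]) auto
  ultimately have "\<forall>\<^sub>F n in sequentially. False"
  proof eventually_elim
    case (elim n)
    obtain p where p: "p \<in> T" "p \<noteq> a" "u0 \<le> dist p (\<phi> k \<xi>)" using far by blast
    hence "v \<le> dist (\<phi> (g n) p) (\<phi> (g n) (\<phi> k \<xi>))" using g(1)[of n] v unfolding separators_def by auto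
    thus False using elim p dist_triangle2[of "\<phi> (g n) p" "\<phi> (g n) (\<phi> k \<xi>)" b] by fastforce
  qed
  thus False by simp
qed

text \<open>Minimise the number of separators among translates keeping \<open>z\<close> at distance
  \<open>v\<close>. Separators preserve this constraint, so by minimality the injection
  \<open>f \<mapsto> f \<otimes> g\<close> is onto, and the preimage of \<open>\<one>\<close> is
  \<open>inv g\<close>.\<close>

lemma terminal_exists:
  assumes "h \<in> carrier G" "v \<le> dist (\<phi> h z) (\<phi> h \<xi>)"
  obtains k where "k \<in> carrier G" "v \<le> dist (\<phi> k z) (\<phi> k \<xi>)" "terminal (\<phi> k \<xi>)"
proof -
  obtain k where k: "k \<in> carrier G" "v \<le> dist (\<phi> k z) (\<phi> k \<xi>)"
    and min: "\<And>h. h \<in> carrier G \<Longrightarrow> v \<le> dist (\<phi> h z) (\<phi> h \<xi>) \<Longrightarrow>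
      card (separators (\<phi> k \<xi>)) \<le> card (separators (\<phi> h \<xi>))"
    using ex_has_least_nat[of "\<lambda>h. h \<in> carrier G \<and> v \<le> dist (\<phi> h z) (\<phi> h \<xi>)" h "\<lambda>h. card (separators (\<phi> h \<xi>))"]
      assms by auto
  have "inv g \<in> separators (\<phi> g (\<phi> k \<xi>))" if g: "g \<in> separators (\<phi> k \<xi>)" for g
  proof -
    have gc: "g \<in> carrier G" using g unfolding separators_def by auto
    have sub: "(\<lambda>f. f \<otimes> g) ` separators (\<phi> (g \<otimes> k) \<xi>) \<subseteq> separators (\<phi> k \<xi>)"
      using g gc k(1) unfolding separators_def by (auto simp: act_mult)
    have inj: "inj_on (\<lambda>f. f \<otimes> g) (separators (\<phi> (g \<otimes> k) \<xi>))"
      using gc by (auto simp: inj_on_def separators_def)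
    have "v \<le> dist (\<phi> (g \<otimes> k) z) (\<phi> (g \<otimes> k) \<xi>)"
      using g gc k unfolding separators_def by (simp add: act_mult)
    hence "card (separators (\<phi> k \<xi>)) \<le> card (separators (\<phi> (g \<otimes> k) \<xi>))"
      using min gc k(1) by blast
    hence "(\<lambda>f. f \<otimes> g) ` separators (\<phi> (g \<otimes> k) \<xi>) = separators (\<phi> k \<xi>)"
      using card_image[OF inj] by (intro card_seteq[OF finite_separators[OF k(1)] sub]) simp
    moreover have "\<one> \<in> separators (\<phi> k \<xi>)" unfolding separators_def by simp
    ultimately obtain f where f: "f \<in> separators (\<phi> (g \<otimes> k) \<xi>)" "\<one> = f \<otimes> g" by force
    hence "f = inv g" using gc inv_equality[of f g] unfolding separators_def by auto
    thus ?thesis using f(1) gc k(1) by (simp add: act_mult)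
  qed
  hence "terminal (\<phi> k \<xi>)" unfolding terminal_def using k(1) by blast
  thus thesis using that k by blast
qed

text \<open>
  Such a \<open>g n\<close> would be a separator of \<open>\<eta> n\<close>, hence so would be its inverse for \<open>\<phi> (g n) (\<eta> n)\<close>; but the
  inverses carry some test point far from there to the vicinity of \<open>\<beta>\<close>, where \<open>\<eta> n\<close> lies.
\<close>

lemma terminal_not_expanded:
  assumes g: "conv g \<beta>' \<beta>" and \<eta>: "\<And>n. terminal (\<eta> n)" "\<eta> \<longlonglongrightarrow> \<beta>"
    and far': "\<forall>\<^sub>F n in sequentially. 2 * v \<le> dist (\<phi> (g n) (\<eta> n)) \<beta>'"
  shows False
proof -
  have "\<forall>\<^sub>F n in sequentially. dist (\<eta> n) \<beta> < v / 2" using v by (intro tendstoD \<eta>) auto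
  moreover have "\<forall>\<^sub>F n in sequentially. \<forall>z. v / 2 \<le> dist z \<beta> \<longrightarrow> dist (\<phi> (g n) z) \<beta>' < v"
    using v by (intro convD[OF g]) auto
  moreover have "\<forall>\<^sub>F n in sequentially. \<forall>p\<in>T. p \<noteq> \<beta>' \<longrightarrow> dist (\<phi> (inv (g n)) p) \<beta> < v / 2"
    using v by (intro conv_T[OF conv_inv[OF g]]) auto
  ultimately have "\<forall>\<^sub>F n in sequentially. False" using far'
  proof eventually_elim
    case (elim n)
    have gc: "g n \<in> carrier G" by (rule conv_closed[OF g])
    have "v \<le> dist (\<phi> (g n) z) (\<phi> (g n) (\<eta> n))" if "v \<le> dist z (\<eta> n)" for z
    proof -
      have "v / 2 \<le> dist z \<beta>"
        using that elim(1) dist_triangle2[of z "\<eta> n" \<beta>] by linarith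
      hence "dist (\<phi> (g n) z) \<beta>' < v" using elim(2) by blast
      thus ?thesis using elim(4) dist_triangle3[of "\<phi> (g n) (\<eta> n)" \<beta>' "\<phi> (g n) z"] by linarith
    qed
    hence "g n \<in> separators (\<eta> n)" unfolding separators_def using gc by auto
    hence "inv (g n) \<in> separators (\<phi> (g n) (\<eta> n))" using \<eta>(1)[of n] unfolding terminal_def by blast
    hence *: "v \<le> dist (\<phi> (inv (g n)) w) (\<eta> n)" if "v \<le> dist w (\<phi> (g n) (\<eta> n))" for w
      using that gc unfolding separators_def by simp
    obtain p where p: "p \<in> T" "p \<noteq> \<beta>'" "u0 \<le> dist p (\<phi> (g n) (\<eta> n))" using far by blast
    have "v \<le> dist (\<phi> (inv (g n)) p) (\<eta> n)" using p v by (intro *) auto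
    moreover have "dist (\<phi> (inv (g n)) p) \<beta> < v / 2" using elim(3) p by blast
    ultimately show False using elim(1) dist_triangle2[of "\<phi> (inv (g n)) p" "\<eta> n" \<beta>] by linarith
  qed
  thus False by simp
qed

section \<open>Terminal points do not accumulate\<close>

text \<open>For large \<open>l\<close> the element \<open>\<gamma> l\<close> is hyperbolic with
  fixed points near \<open>\<theta>\<close> and \<open>\<eta>\<close>, and
  \<open>axis_crossing\<close> supplies a wide translate of them. If the image of \<open>z\<close>
  is eventually near that of the repelling point, one of \<open>\<eta>\<close> and its image under
  \<open>\<gamma> l\<close> is the terminal point sought; otherwise a constant subsequence of the
  translating elements decides.\<close>

lemma separated_near_attractors:
  assumes \<gamma>: "conv \<gamma> \<theta> \<eta>" and ne: "\<theta> \<noteq> \<eta>" and t: "terminal \<eta>" "\<And>l. terminal (\<phi> (\<gamma> l) \<eta>)"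
    and lim: "(\<lambda>l. \<phi> (\<gamma> l) \<eta>) \<longlonglongrightarrow> \<theta>" and z: "z \<noteq> \<theta>" "z \<noteq> \<eta>" and "e > 0"
  obtains g \<eta>' a b where "g \<in> carrier G" "terminal \<eta>'"
    "\<And>p. p \<in> {\<eta>', a, b} \<Longrightarrow> dist p \<theta> < e \<or> dist p \<eta> < e"
    "\<delta> \<le> dist (\<phi> g b) (\<phi> g a)" "\<delta> / 5 \<le> dist (\<phi> g \<eta>') (\<phi> g z)"
proof -
  have \<delta>: "\<delta> > 0" using v by linarith
  let ?b = "\<lambda>n. attracting_fixed_point G \<phi> (\<gamma> n)" and ?a = "\<lambda>n. repelling_fixed_point G \<phi> (\<gamma> n)"
  \<comment> \<open>The distances from \<open>z\<close> are included to keep the fixed points of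
    \<open>\<gamma> (l n)\<close> different from \<open>z\<close>.\<close>
  define d where "d n = min (1 / Suc n) (min (dist z \<theta>) (dist z \<eta>))" for n :: nat
  have d: "d n > 0" for n using z by (simp add: d_def)
  have "\<exists>l. hyperbolic G \<phi> (\<gamma> l) \<and> dist (?b l) \<theta> < d n \<and> dist (?a l) \<eta> < d n \<and> dist (\<phi> (\<gamma> l) \<eta>) \<theta> < d n" for n
    using eventually_happens[OF eventually_conj[OF conv_eventually_hyperbolic[OF \<gamma> ne d] tendstoD[OF lim d]]]
    by auto
  then obtain l where l: "\<And>n. hyperbolic G \<phi> (\<gamma> (l n))" "\<And>n. dist (?b (l n)) \<theta> < d n"
    "\<And>n. dist (?a (l n)) \<eta> < d n" "\<And>n. dist (\<phi> (\<gamma> (l n)) \<eta>) \<theta> < d n" by metis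
  define \<Gamma> where "\<Gamma> n = \<gamma> (l n)" for n
  define b where "b n = ?b (l n)" for n
  define a where "a n = ?a (l n)" for n
  have \<Gamma>c: "\<Gamma> n \<in> carrier G" for n unfolding \<Gamma>_def by (rule conv_closed[OF \<gamma>])
  have pw: "conv (\<lambda>k. \<Gamma> n [^] (k::nat)) (b n) (a n)" for n
    unfolding \<Gamma>_def b_def a_def by (rule hyperbolic_fixed_points(3)[OF l(1)])
  have d1: "d n \<le> 1 / Suc n" for n by (simp add: d_def)
  have lb: "b \<longlonglongrightarrow> \<theta>"
    by (rule tendsto_if_dist_lt_inverse[OF _ tendsto_const]) (use order.strict_trans2[OF l(2) d1] in \<open>simp add: b_def\<close>)
  have la: "a \<longlonglongrightarrow> \<eta>"
    by (rule tendsto_if_dist_lt_inverse[OF _ tendsto_const]) (use order.strict_trans2[OF l(3) d1] in \<open>simp add: a_def\<close>)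
  have "z \<noteq> a n" "z \<noteq> b n" for n
    using l(2,3)[of n] unfolding a_def b_def d_def by auto
  moreover have "\<exists>h\<in>carrier G. \<delta> \<le> dist (\<phi> h (b n)) (\<phi> h (a n))" for n
    unfolding b_def a_def by (rule not_escaping[OF l(1)])
  ultimately have "\<exists>g. g \<in> carrier G \<and> \<delta> \<le> dist (\<phi> g (b n)) (\<phi> g (a n)) \<and> \<delta> / 3 \<le> dist (\<phi> g z) (\<phi> g (b n))
      \<and> dist (\<phi> g (\<phi> (\<Gamma> n) z)) (\<phi> g (b n)) < \<delta> / 3" for n
    using axis_crossing[OF \<Gamma>c pw _ \<delta>] by metis
  then obtain g where g: "\<And>n. g n \<in> carrier G" "\<And>n. \<delta> \<le> dist (\<phi> (g n) (b n)) (\<phi> (g n) (a n))"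
    "\<And>n. \<delta> / 3 \<le> dist (\<phi> (g n) z) (\<phi> (g n) (b n))"
    "\<And>n. dist (\<phi> (g n) (\<phi> (\<Gamma> n) z)) (\<phi> (g n) (b n)) < \<delta> / 3" by metis
  show thesis
  proof (cases "\<forall>\<^sub>F n in sequentially. dist (\<phi> (g n) z) (\<phi> (g n) (a n)) < \<delta> / 4")
    case True
    have "\<forall>\<^sub>F n in sequentially. d n < e"
    proof -
      have "\<forall>\<^sub>F n in sequentially. 1 / real (Suc n) < e"
        using order_tendstoD(2)[OF LIMSEQ_Suc[OF lim_const_over_n[of 1]] \<open>e > 0\<close>] by simp
      thus ?thesis by eventually_elim (use d1 le_less_trans in blast)
    qed
    from eventually_happens[OF eventually_conj[OF True this]]
    obtain n where n: "dist (\<phi> (g n) z) (\<phi> (g n) (a n)) < \<delta> / 4" "d n < e" by auto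
    have near: "dist (b n) \<theta> < e" "dist (a n) \<eta> < e" "dist (\<phi> (\<Gamma> n) \<eta>) \<theta> < e"
      using l(2-4)[of n] n(2) unfolding a_def b_def \<Gamma>_def by linarith+
    define q where "q = \<phi> (g n) (\<phi> (\<Gamma> n) \<eta>)"
    have "\<delta> \<le> dist (\<phi> (g n) (b n)) (\<phi> (g n) (\<phi> (\<Gamma> n) z)) + dist (\<phi> (g n) (\<phi> (\<Gamma> n) z)) q
        + dist q (\<phi> (g n) z) + dist (\<phi> (g n) z) (\<phi> (g n) (a n))"
      using g(2)[of n] dist_triangle[of "\<phi> (g n) (b n)" "\<phi> (g n) (a n)" "\<phi> (g n) (\<phi> (\<Gamma> n) z)"]
        dist_triangle[of "\<phi> (g n) (\<phi> (\<Gamma> n) z)" "\<phi> (g n) (a n)" q]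
        dist_triangle[of q "\<phi> (g n) (a n)" "\<phi> (g n) z"] by linarith
    \<comment> \<open>The two distances from \<open>q\<close> add up to at least
      \<open>\<delta> - \<delta> / 3 - \<delta> / 4\<close>, which exceeds
      \<open>2 * \<delta> / 5\<close>. In the second case \<open>\<Gamma> n\<close> is absorbed into
      the group element and \<open>\<eta>\<close> itself is used.\<close>
    hence "\<delta> / 5 \<le> dist q (\<phi> (g n) z) \<or> \<delta> / 5 \<le> dist q (\<phi> (g n) (\<phi> (\<Gamma> n) z))"
      using n(1) g(4)[of n] \<delta> dist_commute[of q "\<phi> (g n) (\<phi> (\<Gamma> n) z)"]
        dist_commute[of "\<phi> (g n) (b n)" "\<phi> (g n) (\<phi> (\<Gamma> n) z)"] by argo
    thus thesis
    proof
      assume "\<delta> / 5 \<le> dist q (\<phi> (g n) z)"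
      thus thesis using that[OF g(1), of "\<phi> (\<Gamma> n) \<eta>" "a n" "b n"] near t(2) g(2)[of n] unfolding q_def \<Gamma>_def by auto
    next
      assume q: "\<delta> / 5 \<le> dist q (\<phi> (g n) (\<phi> (\<Gamma> n) z))"
      have "b n \<in> invariants UNIV \<phi> (\<Gamma> n)" "a n \<in> invariants UNIV \<phi> (\<Gamma> n)"
        using powers_fixed[OF \<Gamma>c pw] by auto
      hence "\<phi> (\<Gamma> n) (b n) = b n" "\<phi> (\<Gamma> n) (a n) = a n" unfolding invariants_def by auto
      moreover have "dist p \<theta> < e \<or> dist p \<eta> < e" if "p \<in> {\<eta>, a n, b n}" for p
        using that near \<open>e > 0\<close> by auto
      ultimately show thesis using t(1) g(1,2)[of n] \<Gamma>c[of n] q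
        by (intro that[of "g n \<otimes> \<Gamma> n" \<eta> "a n" "b n"]) (simp_all add: act_mult q_def)
    qed
  next
    case False
    hence "infinite {n. \<delta> / 4 \<le> dist (\<phi> (g n) z) (\<phi> (g n) (a n))}"
      unfolding eventually_sequentially infinite_nat_iff_unbounded_le by (auto simp: not_less)
    then obtain r where "strict_mono (r::nat\<Rightarrow>nat)" "\<forall>n. r n \<in> {n. \<delta> / 4 \<le> dist (\<phi> (g n) z) (\<phi> (g n) (a n))}"
      using infinite_enumerate by blast
    hence r: "strict_mono r" "\<And>n. \<delta> / 4 \<le> dist (\<phi> (g (r n)) z) (\<phi> (g (r n)) (a (r n)))" by auto
    have lim': "(\<lambda>n. b (r (s n))) \<longlonglongrightarrow> \<theta>" "(\<lambda>n. a (r (s n))) \<longlonglongrightarrow> \<eta>" if "strict_mono s" for s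
      using LIMSEQ_subseq_LIMSEQ[OF LIMSEQ_subseq_LIMSEQ[OF lb r(1)] that]
        LIMSEQ_subseq_LIMSEQ[OF LIMSEQ_subseq_LIMSEQ[OF la r(1)] that] by (simp_all add: comp_def)
    have gr: "\<And>n. g (r n) \<in> carrier G" by (rule g(1))
    from gr show thesis
    proof (cases rule: const_or_conv[of "\<lambda>n. g (r n)"])
      case (const s c)
      have "\<delta> \<le> dist (\<phi> c \<theta>) (\<phi> c \<eta>)"
      proof (rule LIMSEQ_le_const)
        show "(\<lambda>n. dist (\<phi> c (b (r (s n)))) (\<phi> c (a (r (s n))))) \<longlonglongrightarrow> dist (\<phi> c \<theta>) (\<phi> c \<eta>)"
          by (intro tendsto_dist act_tendsto const(3) lim' const(1))
      qed (use g(2)[of "r (s _)"] const(2) in auto)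
      moreover have "\<delta> / 4 \<le> dist (\<phi> c z) (\<phi> c \<eta>)"
      proof (rule LIMSEQ_le_const)
        show "(\<lambda>n. dist (\<phi> c z) (\<phi> c (a (r (s n))))) \<longlonglongrightarrow> dist (\<phi> c z) (\<phi> c \<eta>)"
          by (intro tendsto_dist act_tendsto const(3) lim' const(1) tendsto_const)
      qed (use r(2)[of "s _"] const(2) in auto)
      ultimately show thesis using const(3) t(1) \<open>e > 0\<close> \<delta>
        by (intro that[of c \<eta> \<eta> \<theta>]) (auto simp: dist_commute)
    next
      case (conv s \<beta> \<alpha>)
      define G where "G n = g (r (s n))" for n
      have G: "conv G \<beta> \<alpha>" unfolding G_def by (rule conv(3))
      \<comment> \<open>A convergence sequence collapses any two of the limits
        \<open>\<theta>\<close>, \<open>\<eta>\<close>, \<open>z\<close> that differ from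
        \<open>\<alpha>\<close>. All three pairs stay apart, yet at most one of these distinct
        points is \<open>\<alpha>\<close>.\<close>
      have sep1: "\<not> (\<theta> \<noteq> \<alpha> \<and> \<eta> \<noteq> \<alpha>)"
      proof
        assume *: "\<theta> \<noteq> \<alpha> \<and> \<eta> \<noteq> \<alpha>"
        from eventually_happens[OF conv_triple[OF G lim'[OF conv(1)] conjunct1[OF *] conjunct2[OF *] \<delta>]]
        show False using g(2) unfolding G_def by (auto simp: not_less[symmetric])
      qed
      have sep2: "\<not> (z \<noteq> \<alpha> \<and> \<eta> \<noteq> \<alpha>)"
      proof
        assume *: "z \<noteq> \<alpha> \<and> \<eta> \<noteq> \<alpha>"
        from eventually_happens[OF conv_triple[OF G tendsto_const[of z] lim'(2)[OF conv(1)] conjunct1[OF *] conjunct2[OF *], of "\<delta> / 4"]]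
        show False using r(2) \<delta> unfolding G_def by (auto simp: not_less[symmetric])
      qed
      have sep3: "\<not> (z \<noteq> \<alpha> \<and> \<theta> \<noteq> \<alpha>)"
      proof
        assume *: "z \<noteq> \<alpha> \<and> \<theta> \<noteq> \<alpha>"
        from eventually_happens[OF conv_triple[OF G tendsto_const[of z] lim'(1)[OF conv(1)] conjunct1[OF *] conjunct2[OF *], of "\<delta> / 3"]]
        show False using g(3) \<delta> unfolding G_def by (auto simp: not_less[symmetric])
      qed
      show thesis using sep1 sep2 sep3 z ne by metis
    qed
  qed
qed

text \<open>With \<open>z\<close> fixed off \<open>\<beta>\<close>, ever closer configurations yield
  elements keeping \<open>a n\<close> and \<open>b n\<close> apart although both tend to
  \<open>\<beta>\<close>; so \<open>\<beta>\<close> is their repelling point and \<open>z\<close>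
  goes to the attracting one. The terminal points \<open>\<eta> n\<close>, kept away from
  \<open>z\<close>, contradict \<open>terminal_not_expanded\<close>.\<close>

lemma terminal_not_accumulating:
  assumes *: "\<And>e. e > 0 \<Longrightarrow> \<exists>\<eta> \<theta> \<gamma>. conv \<gamma> \<theta> \<eta> \<and> \<theta> \<noteq> \<eta> \<and> terminal \<eta> \<and> (\<forall>l. terminal (\<phi> (\<gamma> l) \<eta>))
      \<and> (\<lambda>l. \<phi> (\<gamma> l) \<eta>) \<longlonglongrightarrow> \<theta> \<and> dist \<eta> \<beta> < e \<and> dist \<theta> \<beta> < e"
  shows False
proof -
  have \<delta>: "\<delta> > 0" using v by linarith
  obtain z where z: "z \<noteq> \<beta>" using third by blast
  define P where "P e g \<eta>' a b \<longleftrightarrow> g \<in> carrier G \<and> terminal \<eta>' \<and> dist \<eta>' \<beta> < e \<and> dist a \<beta> < e \<and> dist b \<beta> < e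
    \<and> \<delta> \<le> dist (\<phi> g b) (\<phi> g a) \<and> \<delta> / 5 \<le> dist (\<phi> g \<eta>') (\<phi> g z)" for e :: real and g \<eta>' a b
  have "\<exists>g \<eta>' a b. P e g \<eta>' a b" if "e > 0" for e
  proof -
    \<comment> \<open>Half of \<open>e\<close> allows for the triangle inequality; the other bound
      keeps \<open>z\<close> off \<open>\<eta>\<close> and \<open>\<theta>\<close>.\<close>
    define e' where "e' = min (e / 2) (dist z \<beta>)"
    have e': "e' > 0" "e' \<le> e / 2" using z that by (auto simp: e'_def)
    obtain \<eta> \<theta> \<gamma> where h: "conv \<gamma> \<theta> \<eta>" "\<theta> \<noteq> \<eta>" "terminal \<eta>" "\<And>l. terminal (\<phi> (\<gamma> l) \<eta>)"
      "(\<lambda>l. \<phi> (\<gamma> l) \<eta>) \<longlonglongrightarrow> \<theta>" and near: "dist \<eta> \<beta> < e'" "dist \<theta> \<beta> < e'" using *[OF e'(1)] by blast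
    have "z \<noteq> \<theta>" "z \<noteq> \<eta>" using near by (auto simp: e'_def)
    from separated_near_attractors[OF h this e'(1)]
    obtain g \<eta>' a b where g: "g \<in> carrier G" "terminal \<eta>'"
      "\<And>p. p \<in> {\<eta>', a, b} \<Longrightarrow> dist p \<theta> < e' \<or> dist p \<eta> < e'"
      "\<delta> \<le> dist (\<phi> g b) (\<phi> g a)" "\<delta> / 5 \<le> dist (\<phi> g \<eta>') (\<phi> g z)" by metis
    have "dist p \<beta> < e" if "p \<in> {\<eta>', a, b}" for p
      using g(3)[OF that] near e'(2) dist_triangle[of p \<beta> \<theta>] dist_triangle[of p \<beta> \<eta>] by linarith
    hence "P e g \<eta>' a b" unfolding P_def using g by auto
    thus ?thesis by blast
  qed
  hence "\<exists>g \<eta>' a b. P (1 / Suc n) g \<eta>' a b" for n by simp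
  then obtain g \<eta> a b where gP: "\<And>n. P (1 / Suc n) (g n) (\<eta> n) (a n) (b n)" by metis
  have g: "g n \<in> carrier G" and ab: "\<delta> \<le> dist (\<phi> (g n) (b n)) (\<phi> (g n) (a n))"
    and t: "terminal (\<eta> n)" and gz: "\<delta> / 5 \<le> dist (\<phi> (g n) (\<eta> n)) (\<phi> (g n) z)" for n
    using gP[of n] unfolding P_def by auto
  have near: "dist (\<eta> n) \<beta> < 1 / Suc n" "dist (a n) \<beta> < 1 / Suc n" "dist (b n) \<beta> < 1 / Suc n" for n
    using gP[of n] unfolding P_def by auto
  note lims = tendsto_if_dist_lt_inverse[OF near(1) tendsto_const] tendsto_if_dist_lt_inverse[OF near(2) tendsto_const]
    tendsto_if_dist_lt_inverse[OF near(3) tendsto_const]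
  have lims': "(\<lambda>n. \<eta> (r n)) \<longlonglongrightarrow> \<beta>" "(\<lambda>n. a (r n)) \<longlonglongrightarrow> \<beta>" "(\<lambda>n. b (r n)) \<longlonglongrightarrow> \<beta>" if "strict_mono r" for r
    using lims[THEN LIMSEQ_subseq_LIMSEQ, OF that] by (simp_all add: comp_def)
  from g show False
  proof (cases rule: const_or_conv[of g])
    case (const r c)
    have "(\<lambda>n. dist (\<phi> c (b (r n))) (\<phi> c (a (r n)))) \<longlonglongrightarrow> dist (\<phi> c \<beta>) (\<phi> c \<beta>)"
      by (intro tendsto_dist act_tendsto const(3) lims' const(1))
    hence "\<delta> \<le> dist (\<phi> c \<beta>) (\<phi> c \<beta>)"
      by (rule LIMSEQ_le_const) (use ab[of "r _"] const(2) in auto)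
    thus False using \<delta> by simp
  next
    case (conv r \<beta>' \<alpha>)
    have \<alpha>: "\<alpha> = \<beta>"
    proof (rule ccontr)
      assume "\<alpha> \<noteq> \<beta>"
      hence "\<beta> \<noteq> \<alpha>" by simp
      from eventually_happens[OF conv_triple[OF conv(3) lims'(3)[OF conv(1)] lims'(2)[OF conv(1)] this this \<delta>]]
      show False using ab by (auto simp: not_less[symmetric])
    qed
    have "(\<lambda>n. \<phi> (g (r n)) z) \<longlonglongrightarrow> \<beta>'" using z \<alpha> by (intro conv_tendsto[OF conv(3) tendsto_const]) auto
    hence "\<forall>\<^sub>F n in sequentially. dist (\<phi> (g (r n)) z) \<beta>' < \<delta> / 30" using \<delta> by (intro tendstoD) auto
    hence "\<forall>\<^sub>F n in sequentially. 2 * v \<le> dist (\<phi> (g (r n)) (\<eta> (r n))) \<beta>'"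
    proof eventually_elim
      case (elim n)
      thus ?case using gz[of "r n"] v dist_triangle2[of "\<phi> (g (r n)) (\<eta> (r n))" "\<phi> (g (r n)) z" \<beta>'] by linarith
    qed
    thus False using terminal_not_expanded[OF conv(3)[unfolded \<alpha>] t lims'(1)[OF conv(1)]] by blast
  qed
qed

section \<open>The stabilizer of the non-conical point and its cocompactness\<close>

text \<open>Let \<open>b n\<close> attract to \<open>y\<close> and repel from \<open>b'\<close>. A
  test point \<open>w\<close> far from \<open>b'\<close> is carried to \<open>z n\<close>, near
  \<open>y\<close>. The inverse of \<open>b n\<close> takes \<open>z n\<close> back to
  \<open>w\<close> and, \<open>\<xi>\<close> being non-conical, takes \<open>\<xi>\<close> near
  \<open>b'\<close>; so it separates them and \<open>terminal_exists\<close> applies.\<close>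

lemma terminal_approach:
  assumes "y \<in> \<Lambda>"
  obtains z k where "z \<longlonglongrightarrow> y" "\<And>n. k n \<in> carrier G" "\<And>n. terminal (\<phi> (k n) \<xi>)"
    "\<And>n. v \<le> dist (\<phi> (k n) (z n)) (\<phi> (k n) \<xi>)"
proof -
  obtain b b' where b: "conv b y b'" using assms limit_set_iff by blast
  obtain w where w: "w \<in> T" "w \<noteq> b'" "u0 \<le> dist w b'" using far by blast
  have "(\<lambda>n. \<phi> (inv (b n)) \<xi>) \<longlonglongrightarrow> b'" by (rule nonconical_tendsto[OF nonconical conv_inv[OF b]])
  hence "\<forall>\<^sub>F n in sequentially. dist (\<phi> (inv (b n)) \<xi>) b' < v" using v by (intro tendstoD) auto
  then obtain N where N: "\<And>n. n \<ge> N \<Longrightarrow> dist (\<phi> (inv (b n)) \<xi>) b' < v"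
    unfolding eventually_sequentially by blast
  define z where "z n = \<phi> (b (n + N)) w" for n
  have bc: "b n \<in> carrier G" for n by (rule conv_closed[OF b])
  have "(\<lambda>n. \<phi> (b n) w) \<longlonglongrightarrow> y" using w by (intro conv_tendsto[OF b tendsto_const])
  hence z: "z \<longlonglongrightarrow> y" unfolding z_def[abs_def] by (rule LIMSEQ_ignore_initial_segment)
  have "\<exists>k. k \<in> carrier G \<and> terminal (\<phi> k \<xi>) \<and> v \<le> dist (\<phi> k (z n)) (\<phi> k \<xi>)" for n
  proof -
    have "v \<le> dist w (\<phi> (inv (b (n + N))) \<xi>)"
      using N[of "n + N"] w(3) v dist_triangle[of w b' "\<phi> (inv (b (n + N))) \<xi>"] by simp
    hence "v \<le> dist (\<phi> (inv (b (n + N))) (z n)) (\<phi> (inv (b (n + N))) \<xi>)"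
      unfolding z_def using bc by simp
    from terminal_exists[OF _ this] show ?thesis using bc by blast
  qed
  then obtain k where "\<And>n. k n \<in> carrier G" "\<And>n. terminal (\<phi> (k n) \<xi>)"
    "\<And>n. v \<le> dist (\<phi> (k n) (z n)) (\<phi> (k n) \<xi>)" by metis
  thus thesis using that z by blast
qed

text \<open>Points \<open>z n\<close> tending to \<open>\<xi>\<close> stay separated from it by
  \<open>k n\<close>, so \<open>k n\<close> subconverges with repelling point \<open>\<xi>\<close>.
  A finite stabilizer would let only finitely many translates of \<open>\<xi>\<close> equal their
  limit \<open>\<beta>\<close>, and the others would be terminal points accumulating there.\<close>

lemma infinite_stabilizer: "infinite (stabilizer G \<phi> \<xi>)"
proof
  assume fin: "finite (stabilizer G \<phi> \<xi>)"
  obtain z k where z: "z \<longlonglongrightarrow> \<xi>" and k: "\<And>n. k n \<in> carrier G" "\<And>n. terminal (\<phi> (k n) \<xi>)"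
    "\<And>n. v \<le> dist (\<phi> (k n) (z n)) (\<phi> (k n) \<xi>)" using terminal_approach[OF \<xi>] by blast
  have zr: "(\<lambda>n. z (r n)) \<longlonglongrightarrow> \<xi>" if "strict_mono r" for r
    using LIMSEQ_subseq_LIMSEQ[OF z that] by (simp add: comp_def)
  from k(1) show False
  proof (cases rule: const_or_conv[of k])
    case (const r c)
    have "(\<lambda>n. dist (\<phi> c (z (r n))) (\<phi> c \<xi>)) \<longlonglongrightarrow> dist (\<phi> c \<xi>) (\<phi> c \<xi>)"
      by (intro tendsto_dist act_tendsto const(3) zr const(1) tendsto_const)
    hence "v \<le> dist (\<phi> c \<xi>) (\<phi> c \<xi>)"
      by (rule LIMSEQ_le_const) (use k(3)[of "r _"] const(2) in auto)
    thus False using v by simp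
  next
    case (conv r \<beta> \<alpha>)
    have lim: "(\<lambda>n. \<phi> (k (r n)) \<xi>) \<longlonglongrightarrow> \<beta>" by (rule nonconical_tendsto[OF nonconical conv(3)])
    have \<alpha>: "\<alpha> = \<xi>"
    proof (rule ccontr)
      assume "\<alpha> \<noteq> \<xi>"
      hence "\<xi> \<noteq> \<alpha>" by simp
      from eventually_happens[OF conv_triple[OF conv(3) zr[OF conv(1)] tendsto_const this this v(1)]]
      show False using k(3) by (auto simp: not_less[symmetric])
    qed
    define Z where "Z = {n. \<phi> (k (r n)) \<xi> = \<beta>}"
    have "finite Z"
    proof (cases "Z = {}")
      case False
      then obtain m where m: "m \<in> Z" by blast
      \<comment> \<open>Elements taking \<open>\<xi>\<close> to the same point differ by stabilizer
        elements.\<close>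
      have "inj_on (\<lambda>n. inv (k (r m)) \<otimes> k (r n)) Z"
        using conv(2) k(1) by (auto simp: inj_on_def)
      moreover have "(\<lambda>n. inv (k (r m)) \<otimes> k (r n)) ` Z \<subseteq> stabilizer G \<phi> \<xi>"
      proof safe
        fix n assume "n \<in> Z"
        hence "\<phi> (k (r n)) \<xi> = \<phi> (k (r m)) \<xi>" using m by (simp add: Z_def)
        thus "inv (k (r m)) \<otimes> k (r n) \<in> stabilizer G \<phi> \<xi>"
          unfolding stabilizer_def using k(1) by (simp add: act_mult)
      qed
      ultimately show ?thesis using fin finite_imageD finite_subset by blast
    qed simp
    show False
    proof (rule terminal_not_accumulating)
      fix e :: real assume "e > 0"
      have "\<forall>\<^sub>F n in sequentially. n \<notin> Z"
        using \<open>finite Z\<close> by (simp add: eventually_cofinite cofinite_eq_sequentially[symmetric])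
      from eventually_happens[OF eventually_conj[OF this tendstoD[OF lim \<open>e > 0\<close>]]]
      obtain n where n: "\<phi> (k (r n)) \<xi> \<noteq> \<beta>" "dist (\<phi> (k (r n)) \<xi>) \<beta> < e" unfolding Z_def by auto
      define \<gamma> where "\<gamma> l = k (r l) \<otimes> inv (k (r n))" for l
      have "conv \<gamma> \<beta> (\<phi> (k (r n)) \<xi>)" unfolding \<gamma>_def[abs_def]
        using conv_right[OF conv(3) k(1)[of "r n"]] \<alpha> by simp
      moreover have "\<phi> (\<gamma> l) (\<phi> (k (r n)) \<xi>) = \<phi> (k (r l)) \<xi>" for l
        unfolding \<gamma>_def using k(1) by (simp add: act_mult)
      ultimately show "\<exists>\<eta> \<theta> \<gamma>. conv \<gamma> \<theta> \<eta> \<and> \<theta> \<noteq> \<eta> \<and> terminal \<eta> \<and> (\<forall>l. terminal (\<phi> (\<gamma> l) \<eta>))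
          \<and> (\<lambda>l. \<phi> (\<gamma> l) \<eta>) \<longlonglongrightarrow> \<theta> \<and> dist \<eta> \<beta> < e \<and> dist \<theta> \<beta> < e"
        using k(2) lim n \<open>e > 0\<close>
        by (intro exI[of _ "\<phi> (k (r n)) \<xi>"] exI[of _ \<beta>] exI[of _ \<gamma>]) auto
    qed
  qed
qed

lemma stabilizer_conv:
  assumes "conv s b a" "\<And>n. s n \<in> stabilizer G \<phi> \<xi>"
  shows "b = \<xi>" "a = \<xi>"
proof -
  have fix1: "\<phi> (s n) \<xi> = \<xi>" "s n \<in> carrier G" for n using assms(2)[of n] unfolding stabilizer_def by auto
  have fix2: "\<phi> (inv (s n)) \<xi> = \<xi>" for n using act_inv[OF fix1(2), of n \<xi>] fix1(1) by simp
  show "b = \<xi>" using nonconical_tendsto[OF nonconical assms(1)] fix1 by (simp add: LIMSEQ_const_iff)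
  show "a = \<xi>" using nonconical_tendsto[OF nonconical conv_inv[OF assms(1)]] fix2 by (simp add: LIMSEQ_const_iff)
qed

text \<open>A convergence sequence in the stabilizer has \<open>\<xi>\<close> as both of its points.
  Composed with elements carrying \<open>\<xi>\<close> to two terminal points, it repels from one,
  attracts to the other, and maps the first exactly to the second; infinitely many terminal points
  would accumulate.\<close>

lemma finite_terminal: "finite {\<eta>. terminal \<eta>}"
proof (rule ccontr)
  assume "infinite {\<eta>. terminal \<eta>}"
  then obtain f :: "nat \<Rightarrow> 'm" where f: "inj f" "range f \<subseteq> {\<eta>. terminal \<eta>}"
    using infinite_countable_subset by blast
  obtain r \<beta> where r: "strict_mono (r :: nat \<Rightarrow> nat)" "(\<lambda>n. f (r n)) \<longlonglongrightarrow> \<beta>" by (rule subseq_lim)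
  obtain s b a where s: "\<And>n. s n \<in> stabilizer G \<phi> \<xi>" "conv s b a"
  proof (rule infinite_conv[OF infinite_stabilizer stabilizer_subset])
  qed (rule that)
  have ab: "b = \<xi>" "a = \<xi>" using stabilizer_conv[OF s(2,1)] by auto
  show False
  proof (rule terminal_not_accumulating)
    fix e :: real assume "e > 0"
    from tendstoD[OF r(2) this] obtain N where N: "\<And>n. n \<ge> N \<Longrightarrow> dist (f (r n)) \<beta> < e"
      unfolding eventually_sequentially by blast
    define \<eta> \<theta> where "\<eta> = f (r N)" and "\<theta> = f (r (Suc N))"
    have t: "terminal \<eta>" "terminal \<theta>" using f(2) by (auto simp: \<eta>_def \<theta>_def)
    have ne: "\<theta> \<noteq> \<eta>" using f(1) r(1) by (simp add: \<eta>_def \<theta>_def inj_eq strict_mono_eq)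
    obtain k k' where k: "k \<in> carrier G" "\<eta> = \<phi> k \<xi>" "k' \<in> carrier G" "\<theta> = \<phi> k' \<xi>"
      using t unfolding terminal_def by blast
    define \<gamma> where "\<gamma> l = k' \<otimes> (s l \<otimes> inv k)" for l
    have "conv \<gamma> \<theta> \<eta>" unfolding \<gamma>_def[abs_def]
      using conv_left[OF conv_right[OF s(2) k(1)] k(3)] ab k by simp
    moreover have "\<phi> (\<gamma> l) \<eta> = \<theta>" for l
      using s(1)[of l] k unfolding \<gamma>_def stabilizer_def by (simp add: act_mult)
    ultimately show "\<exists>\<eta> \<theta> \<gamma>. conv \<gamma> \<theta> \<eta> \<and> \<theta> \<noteq> \<eta> \<and> terminal \<eta> \<and> (\<forall>l. terminal (\<phi> (\<gamma> l) \<eta>))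
          \<and> (\<lambda>l. \<phi> (\<gamma> l) \<eta>) \<longlonglongrightarrow> \<theta> \<and> dist \<eta> \<beta> < e \<and> dist \<theta> \<beta> < e"
      using t ne N[of N] N[of "Suc N"]
      by (intro exI[of _ \<eta>] exI[of _ \<theta>] exI[of _ \<gamma>]) (auto simp: \<eta>_def \<theta>_def)
  qed
qed

text \<open>If the elements from \<open>terminal_approach\<close> have no constant subsequence,
  finiteness lets them take \<open>\<xi>\<close> to a single \<open>\<eta>\<close>. They then differ
  by stabilizer elements, which push \<open>z n\<close> to \<open>\<xi>\<close> since
  \<open>y \<noteq> \<xi>\<close>; so the images of \<open>z n\<close> tend to
  \<open>\<eta>\<close>, against the bound \<open>v\<close>.\<close>

lemma terminal_separates:
  assumes y: "y \<in> \<Lambda>" "y \<noteq> \<xi>"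
  obtains k where "k \<in> carrier G" "terminal (\<phi> k \<xi>)" "v \<le> dist (\<phi> k y) (\<phi> k \<xi>)"
proof -
  obtain z k where z: "z \<longlonglongrightarrow> y" and k: "\<And>n. k n \<in> carrier G" "\<And>n. terminal (\<phi> (k n) \<xi>)"
    "\<And>n. v \<le> dist (\<phi> (k n) (z n)) (\<phi> (k n) \<xi>)" using terminal_approach[OF y(1)] by blast
  have zr: "(\<lambda>n. z (r n)) \<longlonglongrightarrow> y" if "strict_mono r" for r
    using LIMSEQ_subseq_LIMSEQ[OF z that] by (simp add: comp_def)
  from k(1) show thesis
  proof (cases rule: const_or_conv[of k])
    case (const r c)
    have "(\<lambda>n. dist (\<phi> c (z (r n))) (\<phi> c \<xi>)) \<longlonglongrightarrow> dist (\<phi> c y) (\<phi> c \<xi>)"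
      by (intro tendsto_dist act_tendsto const(3) zr const(1) tendsto_const)
    hence "v \<le> dist (\<phi> c y) (\<phi> c \<xi>)"
      by (rule LIMSEQ_le_const) (use k(3)[of "r _"] const(2) in auto)
    moreover have "terminal (\<phi> c \<xi>)" using k(2) const(2) by metis
    ultimately show thesis using that const(3) by blast
  next
    case (conv r \<beta> \<alpha>)
    have "finite (range (\<lambda>n. \<phi> (k (r n)) \<xi>))" using k(2) by (intro finite_subset[OF _ finite_terminal]) auto
    then obtain \<eta> where "infinite {n. \<phi> (k (r n)) \<xi> = \<eta>}"
      using pigeonhole_infinite[of UNIV "\<lambda>n. \<phi> (k (r n)) \<xi>"] by auto
    then obtain s where "strict_mono (s::nat\<Rightarrow>nat)" "\<forall>n. s n \<in> {n. \<phi> (k (r n)) \<xi> = \<eta>}"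
      using infinite_enumerate by blast
    hence s: "strict_mono s" "\<And>n. \<phi> (k (r (s n))) \<xi> = \<eta>" by auto
    define K where "K n = k (r (s n))" for n
    have K: "K n \<in> carrier G" "\<phi> (K n) \<xi> = \<eta>" for n using k(1) s(2) by (simp_all add: K_def)
    have "conv (\<lambda>n. inv (K 0) \<otimes> K n) (\<phi> (inv (K 0)) \<beta>) \<alpha>"
      unfolding K_def using conv_subseq[OF conv(3) s(1)] k(1) by (intro conv_left) auto
    moreover have "inv (K 0) \<otimes> K n \<in> stabilizer G \<phi> \<xi>" for n
    proof -
      have "\<phi> (inv (K 0)) \<eta> = \<xi>" using act_inv[OF K(1), of 0 \<xi>] K(2) by simp
      thus ?thesis unfolding stabilizer_def using K by (simp add: act_mult)
    qed
    ultimately have c: "conv (\<lambda>n. inv (K 0) \<otimes> K n) \<xi> \<xi>" using stabilizer_conv by metis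
    have zs: "(\<lambda>n. z (r (s n))) \<longlonglongrightarrow> y" using LIMSEQ_subseq_LIMSEQ[OF zr[OF conv(1)] s(1)] by (simp add: comp_def)
    have "(\<lambda>n. \<phi> (inv (K 0) \<otimes> K n) (z (r (s n)))) \<longlonglongrightarrow> \<xi>" by (rule conv_tendsto[OF c zs y(2)])
    hence "(\<lambda>n. \<phi> (K 0) (\<phi> (inv (K 0) \<otimes> K n) (z (r (s n))))) \<longlonglongrightarrow> \<phi> (K 0) \<xi>" by (intro act_tendsto K(1))
    hence "(\<lambda>n. \<phi> (K n) (z (r (s n)))) \<longlonglongrightarrow> \<eta>" using K by (simp add: act_mult)
    from eventually_happens[OF tendstoD[OF this v(1)]]
    obtain n where "dist (\<phi> (K n) (z (r (s n)))) \<eta> < v" by auto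
    thus thesis using k(3)[of "r (s n)"] K(2)[of n] unfolding K_def by simp
  qed
qed

lemma nonconical_bounded_parabolic: "bounded_parabolic G \<phi> \<xi>"
proof -
  have "limit_set \<phi> (stabilizer G \<phi> \<xi>) = {\<xi>}"
  proof -
    have "b = \<xi>" if "b \<in> limit_set \<phi> (stabilizer G \<phi> \<xi>)" for b
    proof -
      have "\<exists>s a. conv s b a \<and> (\<forall>n. \<phi> (s n) \<xi> = \<xi>)"
        using that by (simp only: limit_set_stabilizer_iff)
      then obtain s a where s: "conv s b a" "\<forall>n. \<phi> (s n) \<xi> = \<xi>" by blast
      have "s n \<in> stabilizer G \<phi> \<xi>" for n
        using s(2) conv_closed[OF s(1)] by (simp add: stabilizer_def)
      thus ?thesis by (rule stabilizer_conv(1)[OF s(1)])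
    qed
    moreover have "\<xi> \<in> limit_set \<phi> (stabilizer G \<phi> \<xi>)"
    proof -
      obtain s b a where s: "\<And>n. s n \<in> stabilizer G \<phi> \<xi>" "conv s b a"
      proof (rule infinite_conv[OF infinite_stabilizer stabilizer_subset])
  qed (rule that)
      have "b = \<xi>" using stabilizer_conv(1)[OF s(2,1)] .
      thus ?thesis unfolding limit_set_stabilizer_iff using s by (auto simp: stabilizer_def)
    qed
    ultimately show ?thesis by blast
  qed
  hence par: "parabolic G \<phi> \<xi>" unfolding parabolic_def using infinite_stabilizer by blast
  have "\<exists>k. k \<in> carrier G \<and> \<phi> k \<xi> = \<eta>" if "terminal \<eta>" for \<eta> using that unfolding terminal_def by blast
  then obtain kk where kk: "\<And>\<eta>. terminal \<eta> \<Longrightarrow> kk \<eta> \<in> carrier G" "\<And>\<eta>. terminal \<eta> \<Longrightarrow> \<phi> (kk \<eta>) \<xi> = \<eta>" by metis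
  have "\<exists>d>0. \<forall>x. dist x \<xi> < d \<longrightarrow> dist (\<phi> (kk \<eta>) x) \<eta> < v" if "terminal \<eta>" for \<eta>
    using act_unif[OF kk(1)[OF that] v(1)] kk(2)[OF that] by metis
  then obtain d where d: "\<And>\<eta>. terminal \<eta> \<Longrightarrow> d \<eta> > (0::real)"
    "\<And>\<eta> x. terminal \<eta> \<Longrightarrow> dist x \<xi> < d \<eta> \<Longrightarrow> dist (\<phi> (kk \<eta>) x) \<eta> < v" by metis
  \<comment> \<open>Within \<open>D\<close> of \<open>\<xi>\<close> every chosen
    \<open>kk \<eta>\<close> moves points closer than \<open>v\<close> to \<open>\<eta>\<close>;
    finiteness of the terminal points makes \<open>D\<close> positive, and \<open>1\<close> keeps
    the set nonempty.\<close>
  define D where "D = Min (insert 1 (d ` {\<eta>. terminal \<eta>}))"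
  have fin: "finite (insert 1 (d ` {\<eta>. terminal \<eta>}))" using finite_terminal by simp
  hence D_le: "D \<le> d \<eta>" if "terminal \<eta>" for \<eta> unfolding D_def using that by (intro Min_le) auto
  have "D \<in> insert 1 (d ` {\<eta>. terminal \<eta>})" unfolding D_def by (rule Min_in[OF fin]) simp
  hence D: "D > 0" using d(1) by auto
  define K where "K = \<Lambda> \<inter> {y. D \<le> dist y \<xi>}"
  have "closed K" unfolding K_def by (intro closed_Int closed_limit_set closed_Collect_le continuous_intros)
  hence "compact K" using compact_M closed_Int_compact[of K UNIV] by simp
  moreover have "K \<subseteq> \<Lambda> - {\<xi>}" unfolding K_def using D by auto
  moreover have "(\<Union>h\<in>stabilizer G \<phi> \<xi>. \<phi> h ` K) = \<Lambda> - {\<xi>}"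
  proof (intro equalityI subsetI)
    fix y assume "y \<in> (\<Union>h\<in>stabilizer G \<phi> \<xi>. \<phi> h ` K)"
    then obtain h x where h: "h \<in> carrier G" "\<phi> h \<xi> = \<xi>" "x \<in> K" "y = \<phi> h x"
      unfolding stabilizer_def by auto
    have "x \<in> \<Lambda>" "x \<noteq> \<xi>" using h(3) D unfolding K_def by auto
    thus "y \<in> \<Lambda> - {\<xi>}" using h(1,2,4) limit_set_act by (metis Diff_iff act_eq_iff empty_iff insert_iff)
  next
    fix y assume y: "y \<in> \<Lambda> - {\<xi>}"
    then obtain k where k: "k \<in> carrier G" "terminal (\<phi> k \<xi>)" "v \<le> dist (\<phi> k y) (\<phi> k \<xi>)"
      using terminal_separates by blast
    define f where "f = kk (\<phi> k \<xi>)"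
    have f: "f \<in> carrier G" "\<phi> f \<xi> = \<phi> k \<xi>" using kk k(2) by (simp_all add: f_def)
    \<comment> \<open>Both \<open>f\<close> and \<open>k\<close> take \<open>\<xi>\<close> to the
      same terminal point, so \<open>s\<close> fixes \<open>\<xi>\<close>; since \<open>k\<close>
      separates \<open>y\<close> from \<open>\<xi>\<close>, the point \<open>\<phi> s y\<close>
      cannot be within \<open>D\<close> of \<open>\<xi>\<close>.\<close>
    define s where "s = inv f \<otimes> k"
    have s: "s \<in> carrier G" "\<phi> f (\<phi> s y) = \<phi> k y" using f k(1) by (simp_all add: s_def act_mult)
    have s\<xi>: "\<phi> s \<xi> = \<xi>" using f k(1) act_inv[OF f(1), of \<xi>] by (simp add: s_def act_mult)
    have "\<not> dist (\<phi> s y) \<xi> < d (\<phi> k \<xi>)"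
      using d(2)[OF k(2), of "\<phi> s y"] k(3) s(2) unfolding f_def by auto
    hence "\<phi> s y \<in> K" unfolding K_def using D_le[OF k(2)] limit_set_act[OF _ s(1)] y by auto
    moreover have "\<phi> (inv s) \<xi> = \<xi>" using act_inv[OF s(1), of \<xi>] s\<xi> by simp
    hence "inv s \<in> stabilizer G \<phi> \<xi>" using s(1) by (simp add: stabilizer_def)
    moreover have "y = \<phi> (inv s) (\<phi> s y)" using s(1) by simp
    ultimately show "y \<in> (\<Union>h\<in>stabilizer G \<phi> \<xi>. \<phi> h ` K)" by blast
  qed
  ultimately have "acts_cocompactly \<phi> (stabilizer G \<phi> \<xi>) (\<Lambda> - {\<xi>})" unfolding acts_cocompactly_def by blast
  thus ?thesis unfolding bounded_parabolic_def using par by blast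
qed

end

section \<open>The two implications\<close>

theorem theorem1p1:
  fixes G :: "('g, 'c) monoid_scheme"
    and \<phi> :: "'g \<Rightarrow> 'm::metric_space \<Rightarrow> 'm"
  assumes "compact (UNIV :: 'm set)"
    and "group G"
    and "convergence_action G \<phi>"
    and "non_elementary G \<phi>"
  shows "geometrically_infinite G \<phi> \<longleftrightarrow>
    (\<exists>g :: nat \<Rightarrow> 'g. (\<forall>n. hyperbolic G \<phi> (g n)) \<and> escaping G \<phi> g)"
proof -
  let ?L = "limit_set \<phi> (carrier G)"
  \<comment> \<open>Non-elementarity gives three distinct limit points, from which the test points
    are made.\<close>
  have "\<exists>S\<subseteq>?L. card S = 3 \<and> finite S"
  proof (cases "finite ?L")
    case True
    hence "3 \<le> card ?L" using assms(4) unfolding non_elementary_def by auto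
    thus ?thesis using obtain_subset_with_card_n by metis
  next
    case False
    thus ?thesis using infinite_arbitrarily_large by metis
  qed
  then obtain S :: "'m set" where "card S = 3" by blast
  then obtain p q r :: 'm where "p \<noteq> q" "q \<noteq> r" "p \<noteq> r" by (auto simp: card_3_iff)
  then obtain T :: "'m set" and u0 where sep: "test_points T u0" using test_points_exist by metis
  interpret three_point_convergence G \<phi> T u0
    using assms sep by (simp add: three_point_convergence_def three_point_convergence_axioms_def)
  show ?thesis
  proof
    assume "\<exists>g :: nat \<Rightarrow> 'g. (\<forall>n. hyperbolic G \<phi> (g n)) \<and> escaping G \<phi> g"
    then obtain g :: "nat \<Rightarrow> 'g" where g: "\<And>n. hyperbolic G \<phi> (g n)" "escaping G \<phi> g" by blast
    obtain u where u: "u 0 = u0" "\<And>r. 0 < u r" "\<And>r. u (Suc r) < u r"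
      "\<And>r g x b. g \<in> carrier G \<Longrightarrow> 1 / Suc r \<le> dist b x \<Longrightarrow>
        (\<forall>z. u0 \<le> dist z x \<longrightarrow> u r \<le> dist (\<phi> g z) (\<phi> g x)) \<Longrightarrow> u (Suc r) \<le> dist (\<phi> g b) (\<phi> g x)"
      using scales_exist by metis
    interpret scaled_convergence G \<phi> T u0 u
      by unfold_locales (use u in auto)
    show "geometrically_infinite G \<phi>"
      unfolding geometrically_infinite_def by (rule escaping_imp_geometrically_infinite[OF g])
  next
    assume inf: "geometrically_infinite G \<phi>"
    show "\<exists>g :: nat \<Rightarrow> 'g. (\<forall>n. hyperbolic G \<phi> (g n)) \<and> escaping G \<phi> g"
    proof (rule ccontr)
      let ?a = "attracting_fixed_point G \<phi>" and ?r = "repelling_fixed_point G \<phi>"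
      assume no: "\<not> ?thesis"
      \<comment> \<open>If no \<open>\<delta>\<close> worked for all hyperbolic elements, those
        failing for \<open>1 / Suc n\<close> would form an escaping sequence.\<close>
      have "\<exists>\<delta>>0. \<forall>\<gamma>. hyperbolic G \<phi> \<gamma> \<longrightarrow> (\<exists>h\<in>carrier G. \<delta> \<le> dist (\<phi> h (?a \<gamma>)) (\<phi> h (?r \<gamma>)))"
      proof (rule ccontr)
        assume neg: "\<not> ?thesis"
        have "\<exists>\<gamma>. hyperbolic G \<phi> \<gamma> \<and> (\<forall>h\<in>carrier G. dist (\<phi> h (?a \<gamma>)) (\<phi> h (?r \<gamma>)) < 1 / Suc n)" for n
        proof -
          have "0 < 1 / real (Suc n)" by simp
          with neg show ?thesis by (meson not_less)
        qed
        then obtain g where g: "\<And>n. hyperbolic G \<phi> (g n)"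
          "\<And>n h. h \<in> carrier G \<Longrightarrow> dist (\<phi> h (?a (g n))) (\<phi> h (?r (g n))) < 1 / Suc n" by metis
        have "escaping G \<phi> g" unfolding escaping_def
        proof (rule Lim_null_comparison[OF always_eventually LIMSEQ_Suc[OF lim_const_over_n[of 1]]], rule allI)
          fix n
          let ?S = "SUP h\<in>carrier G. dist (\<phi> h (?a (g n))) (\<phi> h (?r (g n)))"
          have "?S \<le> 1 / Suc n" using g(2)[of _ n] by (intro cSUP_least) (auto intro: less_imp_le)
          moreover have "0 \<le> ?S" using dist_le_SUP[OF one_closed] zero_le_dist order_trans by blast
          ultimately show "norm ?S \<le> 1 / real (Suc n)" by simp
        qed
        thus False using no g(1) by blast
      qed
      then obtain \<delta> where \<delta>: "\<delta> > 0" "\<And>\<gamma>. hyperbolic G \<phi> \<gamma> \<Longrightarrow>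
        \<exists>h\<in>carrier G. \<delta> \<le> dist (\<phi> h (?a \<gamma>)) (\<phi> h (?r \<gamma>))" by blast
      obtain \<xi> where bad: "\<xi> \<in> \<Lambda>" "\<not> conical G \<phi> \<xi>" "\<not> bounded_parabolic G \<phi> \<xi>"
        using inf unfolding geometrically_infinite_def geometrically_finite_def by blast
      define v where "v = min (\<delta> / 12) (u0 / 2)"
      have v: "0 < v" "12 * v \<le> \<delta>" "2 * v \<le> u0" using \<delta>(1) u0_pos by (auto simp: v_def)
      interpret nonconical_point G \<phi> T u0 \<xi> \<delta> v
        by unfold_locales (use bad \<delta>(2) v in auto)
      show False using nonconical_bounded_parabolic bad(3) by blast
    qed
  qed
qed

end
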